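(* Let $t,n$ be positive integers with $t<n$. Then $$pw(H(t,2,n)) = bw(H(t,2,n)) = \sum_{k = \lfloor (n-t)/2 \rfloor }^{\lfloor (n-t)/2 \rfloor +t -1} \binom{n}{k} + \sum_{a=0}^{\lfloor (n-t-1)/2 \rfloor } \left( \binom{t+2a}{t+a-1} - \binom{t+2a}{a-1} \right).$$
   Context: $H(t,2,n)$ is the graph whose vertices are all binary vectors of length $n$, two distinct vectors being adjacent iff their Hamming distance is at most $t$. $pw(G)$ is the pathwidth of $G$: the minimum over path decompositions of (maximum bag size minus 1). $bw(G)$ is the bandwidth of a graph $G=(V,E)$: $bw(G)=\min_{\phi}\max_{uv\in E}|\phi(u)-\phi(v)|$, the minimum over all bijections $\phi:V\to\{1,\dots,|V|\}$. Convention: $\binom{x}{y}=0$ if $y<0$ or $y>x$. *)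

theory Defs
  imports Complex_Main "Graph_Theory.Pair_Digraph"
begin

text \<open>
  A finite simple graph is a \<^locale>\<open>pair_graph\<close>: each undirected edge is represented by the two
  arcs between its endpoints.
\<close>

definition hamming_dist :: "'a list \<Rightarrow> 'a list \<Rightarrow> nat" where
  "hamming_dist x y = card {i. i < length x \<and> x ! i \<noteq> y ! i}"
  \<comment> \<open>only meaningful for lists of equal length\<close>

definition binary_hamming_graph :: "nat \<Rightarrow> nat \<Rightarrow> bool list pair_pre_digraph" where
  "binary_hamming_graph t n =
    \<lparr> pverts = {x. length x = n},
      parcs = {(x, y). length x = n \<and> length y = n \<and> x \<noteq> y \<and> hamming_dist x y \<le> t} \<rparr>"

text \<open>
  In the following definitions \<open>SUP\<close> ranges over finite sets of naturals, so it is a maximum,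
  and it is 0 over the empty set (the bandwidth of an edgeless graph is 0). \<open>INF\<close> ranges over
  nonempty sets of integers or naturals that are bounded below, so it is a minimum, see
  \<open>pathwidth_le_iff\<close> and \<open>bandwidth_le_iff\<close>.
\<close>

definition path_decomposition :: "'a pair_pre_digraph \<Rightarrow> 'a set list \<Rightarrow> bool" where
  "path_decomposition G Xs \<longleftrightarrow>
     Xs \<noteq> [] \<and>
     \<Union>(set Xs) = pverts G \<and>
     (\<forall>(u, v) \<in> parcs G. \<exists>X \<in> set Xs. u \<in> X \<and> v \<in> X) \<and>
     (\<forall>i j k. i \<le> j \<longrightarrow> j \<le> k \<longrightarrow> k < length Xs \<longrightarrow> Xs ! i \<inter> Xs ! k \<subseteq> Xs ! j)"

text \<open>The width is an integer because the null graph has pathwidth \<open>-1\<close>.\<close>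

definition path_decomposition_width :: "'a set list \<Rightarrow> int" where
  "path_decomposition_width Xs = int (SUP X \<in> set Xs. card X) - 1"

definition pathwidth :: "'a pair_pre_digraph \<Rightarrow> int" where
  "pathwidth G = (INF Xs \<in> {Xs. path_decomposition G Xs}. path_decomposition_width Xs)"

definition labelling_bandwidth :: "'a pair_pre_digraph \<Rightarrow> ('a \<Rightarrow> nat) \<Rightarrow> nat" where
  "labelling_bandwidth G \<phi> = (SUP (u, v) \<in> parcs G. nat \<bar>int (\<phi> u) - int (\<phi> v)\<bar>)"

definition bandwidth :: "'a pair_pre_digraph \<Rightarrow> nat" where
  "bandwidth G = (INF \<phi> \<in> {\<phi>. bij_betw \<phi> (pverts G) {1..card (pverts G)}}. labelling_bandwidth G \<phi>)"

definition binomial_int :: "int \<Rightarrow> int \<Rightarrow> int" where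
  "binomial_int x y = (if y < 0 \<or> y > x then 0 else int (nat x choose nat y))"


lemma hamming_dist_commute:
  "length x = length y \<Longrightarrow> hamming_dist x y = hamming_dist y x"
  unfolding hamming_dist_def by (rule arg_cong[where f = card]) auto

lemma pair_graph_binary_hamming_graph: "pair_graph (binary_hamming_graph t n)"
proof -
  have "finite {x :: bool list. length x = n}"
    using finite_lists_length_eq[of "UNIV :: bool set" n] by simp
  then have fin: "finite (pverts (binary_hamming_graph t n))"
    by (simp add: binary_hamming_graph_def)
  have sub: "parcs (binary_hamming_graph t n)
      \<subseteq> pverts (binary_hamming_graph t n) \<times> pverts (binary_hamming_graph t n)"
    by (auto simp: binary_hamming_graph_def)
  show ?thesis
  proof
    show "finite (parcs (binary_hamming_graph t n))"
      using fin sub by (meson finite_SigmaI finite_subset)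
    show "symmetric (with_proj (binary_hamming_graph t n))"
      unfolding symmetric_def
      by (auto intro!: symI simp: binary_hamming_graph_def hamming_dist_commute)
  qed (use fin sub in \<open>auto simp: binary_hamming_graph_def\<close>)
qed

lemma pathwidth_le_iff:
  "pathwidth G \<le> w \<longleftrightarrow> (\<exists>Xs. path_decomposition G Xs \<and> path_decomposition_width Xs \<le> w)"
  if "pair_graph G"
proof -
  interpret pair_graph G by fact
  let ?S = "path_decomposition_width ` {Xs. path_decomposition G Xs}"
  have "path_decomposition G [pverts G]"
    by (auto simp: path_decomposition_def dest: in_arcsD1 in_arcsD2)
  then have ne: "?S \<noteq> {}" by blast
  have bdd: "bdd_below ?S"
    by (rule bdd_belowI[of _ "-1"]) (auto simp: path_decomposition_width_def)
  have "Inf ?S \<in> ?S"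
  proof -
    obtain s where s: "s \<in> ?S" "s < Inf ?S + 1"
      using cInf_lessD[OF ne, of "Inf ?S + 1"] by auto
    with cInf_lower[OF s(1) bdd] show ?thesis by (metis zle_add1_eq_le antisym)
  qed
  with bdd show ?thesis
    unfolding pathwidth_def by (auto intro: cInf_lower order_trans)
qed

lemma bandwidth_le_iff:
  "bandwidth G \<le> b \<longleftrightarrow>
     (\<exists>\<phi>. bij_betw \<phi> (pverts G) {1..card (pverts G)} \<and>
          (\<forall>(u, v) \<in> parcs G. \<bar>int (\<phi> u) - int (\<phi> v)\<bar> \<le> int b))"
  if "pair_graph G"
proof -
  interpret pair_graph G by fact
  let ?S = "labelling_bandwidth G ` {\<phi>. bij_betw \<phi> (pverts G) {1..card (pverts G)}}"
  have "\<exists>\<phi>. bij_betw \<phi> (pverts G) {1..card (pverts G)}"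
    using pair_finite_verts by (simp add: finite_same_card_bij)
  then have "?S \<noteq> {}" by blast
  then have "Inf ?S \<in> ?S" by (rule Inf_nat_def1)
  then have "bandwidth G \<le> b \<longleftrightarrow> (\<exists>s \<in> ?S. s \<le> b)"
    unfolding bandwidth_def by (auto intro: wellorder_InfI cInf_lower order_trans)
  moreover have "labelling_bandwidth G \<phi> \<le> b \<longleftrightarrow>
      (\<forall>(u, v) \<in> parcs G. \<bar>int (\<phi> u) - int (\<phi> v)\<bar> \<le> int b)" for \<phi>
  proof (cases "parcs G = {}")
    case False
    then show ?thesis
      unfolding labelling_bandwidth_def
      by (subst cSUP_le_iff) (auto simp: pair_finite_arcs nat_le_iff intro!: bdd_above_finite)
  qed (simp add: labelling_bandwidth_def Sup_nat_def)
  ultimately show ?thesis by auto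
qed

end

theory Submission
  imports Defs "HOL-Library.Nat_Bijection"
begin

text \<open>
  Identify binary vectors with subsets of \<open>{..<n}\<close> and list the subsets in simplicial order: by
  size, and within a size by decreasing binary value. The position of \<open>X\<close> is a sum over \<open>j < n\<close> of
  partial row sums of binomial coefficients \<open>j choose k\<close>, the \<open>j\<close>-th one having \<open>card (X \<inter> {..j})\<close>
  terms. Changing \<open>t\<close> elements changes each of these partial sums by at most \<open>t\<close> consecutive terms, so
  this listing has bandwidth at most the sum \<open>W\<close> over \<open>j\<close> of the \<open>t\<close> central binomial coefficients
  of row \<open>j\<close>.

  Conversely, order the vertices by the last bag that contains them. In a path decomposition
  the outer boundary of the first \<open>m\<close> vertices, together with the last of them, lies in one bag. By
  Harper's vertex-isoperimetric theorem, iterated \<open>t\<close> times, this boundary is at least that of an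
  initial segment of the simplicial order. If the segment ends with
  \<open>u = {t + 1, t + 3, \<dots>}\<close>, then its \<open>t\<close>-neighbourhood contains \<open>u \<union> {..<t}\<close>, whose position
  exceeds that of \<open>u\<close> by exactly \<open>W\<close>. Hence \<open>W \<le> pw \<le> bw \<le> W\<close>, and \<open>W\<close> is evaluated by
  induction on \<open>n - t\<close> with Pascal's rule.
\<close>

section \<open>Initial segments\<close>

definition initial_segment :: "('a \<Rightarrow> 'b::linorder) \<Rightarrow> 'a set \<Rightarrow> 'a set \<Rightarrow> bool" where
  "initial_segment f U I \<longleftrightarrow> I \<subseteq> U \<and> (\<forall>x\<in>I. \<forall>y\<in>U - I. f x \<le> f y)"
  \<comment> \<open>ties at the boundary of \<open>I\<close> are allowed: several vertices can share their last bag\<close>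

lemma initial_segment_exists:
  assumes "finite U" "m \<le> card U"
  shows "\<exists>I. initial_segment f U I \<and> card I = m"
  using assms(2)
proof (induction m)
  case 0
  show ?case by (intro exI[of _ "{}"]) (simp add: initial_segment_def)
next
  case (Suc m)
  then obtain I where I: "initial_segment f U I" "card I = m" by auto
  then have IU: "I \<subseteq> U" "finite I" using assms(1) by (auto simp: initial_segment_def dest: finite_subset)
  have ne: "U - I \<noteq> {}" using Suc.prems I(2) IU card_mono[of I U] by auto
  define z where "z = arg_min_on f (U - I)"
  have z: "z \<in> U - I" unfolding z_def using assms(1) ne by (intro arg_min_if_finite(1)) auto
  have zmin: "f z \<le> f y" if "y \<in> U - I" for y
    unfolding z_def using assms(1) ne that by (intro arg_min_least) auto
  have "initial_segment f U (insert z I)"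
    using I(1) z zmin by (auto simp: initial_segment_def)
  moreover have "card (insert z I) = Suc m" using z IU I(2) by simp
  ultimately show ?case by blast
qed

lemma initial_segment_memI:
  assumes "initial_segment f U I" "inj_on f U" "x \<in> I" "y \<in> U" "f y \<le> f x"
  shows "y \<in> I"
proof (rule ccontr)
  assume "y \<notin> I"
  then have "f x \<le> f y" using assms by (auto simp: initial_segment_def)
  then have "f x = f y" using assms(5) by simp
  moreover have "x \<in> U" using assms(1,3) by (auto simp: initial_segment_def)
  ultimately have "x = y" using assms(2,4) by (auto dest: inj_onD)
  then show False using \<open>y \<notin> I\<close> assms(3) by simp
qed

lemma initial_segment_linear:
  assumes "initial_segment f U I" "initial_segment f U J" "inj_on f U"
  shows "I \<subseteq> J \<or> J \<subseteq> I"
proof (rule ccontr)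
  assume "\<not> ?thesis"
  then obtain x y where xy: "x \<in> I" "x \<notin> J" "y \<in> J" "y \<notin> I" by blast
  then have "x \<in> U" "y \<in> U" using assms by (auto simp: initial_segment_def)
  then show False
    using xy initial_segment_memI[OF assms(1,3), of x y] initial_segment_memI[OF assms(2,3), of y x] by (meson linear)
qed

lemma initial_segment_card_mono:
  assumes "initial_segment f U I" "initial_segment f U J" "inj_on f U" "finite U"
    "card I \<le> card J"
  shows "I \<subseteq> J"
proof -
  have "finite I" using assms(1,4) by (auto simp: initial_segment_def dest: finite_subset)
  then show ?thesis
    using initial_segment_linear[OF assms(1-3)] assms(5) card_seteq[of I J] by auto
qed

text \<open>All keys on \<open>I - A\<close> are smaller than those on \<open>A - I\<close>, and the
  two sets are equinumerous. The sum of the keys thus serves as a potential that drops strictly when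
  a family is replaced by an initial segment of the same size.\<close>

lemma initial_segment_sum_less:
  fixes f :: "'a \<Rightarrow> int"
  assumes I: "initial_segment f U I" and "inj_on f U" "finite U" "A \<subseteq> U" "card A = card I" "A \<noteq> I"
  shows "sum f I < sum f A"
proof -
  have IU: "I \<subseteq> U" using I by (simp add: initial_segment_def)
  have fin: "finite A" "finite I" using IU assms finite_subset by metis+
  have ca: "card (A - I) = card (I - A)"
    using fin assms(5) by (simp add: card_Diff_subset_Int Int_commute)
  have ne: "I - A \<noteq> {}"
    using fin assms(5,6) card_subset_eq[of A I] by auto
  obtain h where h: "bij_betw h (I - A) (A - I)"
    using finite_same_card_bij[of "I - A" "A - I"] ca fin by auto
  have less: "f x < f y" if "x \<in> I - A" "y \<in> A - I" for x y
  proof -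
    have "y \<in> U" using that assms(4) by blast
    then show ?thesis using initial_segment_memI[OF I assms(2), of x y] that by force
  qed
  have "sum f (I - A) < sum (\<lambda>x. f (h x)) (I - A)"
    using ne fin less h by (intro sum_strict_mono) (auto simp: bij_betw_def)
  also have "\<dots> = sum f (A - I)" using h by (rule sum.reindex_bij_betw)
  finally have "sum f (I - A) < sum f (A - I)" .
  moreover have "sum f I = sum f (I \<inter> A) + sum f (I - A)" using fin by (metis sum.Int_Diff)
  moreover have "sum f A = sum f (I \<inter> A) + sum f (A - I)" using fin by (metis sum.Int_Diff Int_commute)
  ultimately show ?thesis by simp
qed

section \<open>The simplicial order\<close>

lemma set_encode_lessThan: "set_encode {..<M} = 2 ^ M - 1"
proof -
  have "set_encode {..<M} + 1 = 2 ^ M"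
    by (induction M) (auto simp: lessThan_Suc set_encode_def)
  then show ?thesis by linarith
qed

lemma set_encode_mono: "finite Y \<Longrightarrow> X \<subseteq> Y \<Longrightarrow> set_encode X \<le> set_encode Y"
  unfolding set_encode_def by (rule sum_mono2) auto

lemma set_encode_less_power: "X \<subseteq> {..<M} \<Longrightarrow> set_encode X < 2 ^ M"
  using set_encode_mono[of "{..<M}" X] by (simp add: set_encode_lessThan) (metis Suc_pred le_imp_less_Suc pos2 zero_less_power)

lemma power_le_set_encode: "finite X \<Longrightarrow> i \<in> X \<Longrightarrow> 2 ^ i \<le> set_encode X"
  using set_encode_mono[of X "{i}"] by (simp add: set_encode_def)

lemma set_encode_disjoint_Un:
  "finite X \<Longrightarrow> finite Y \<Longrightarrow> X \<inter> Y = {} \<Longrightarrow> set_encode (X \<union> Y) = set_encode X + set_encode Y"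
  unfolding set_encode_def by (rule sum.union_disjoint)

text \<open>Above \<open>d\<close> the set \<open>v\<close> has nothing that \<open>w\<close> lacks,
  and all of \<open>v\<close> below \<open>d\<close> amounts to less than
  \<open>2 ^ d\<close>.\<close>

lemma set_encode_less:
  assumes "finite v" "finite w" "d \<in> w" "d \<notin> v" "\<And>i. i > d \<Longrightarrow> i \<in> v \<Longrightarrow> i \<in> w"
  shows "set_encode v < set_encode w"
proof -
  let ?u = "{i\<in>v. d < i}"
  have "v = {i\<in>v. i < d} \<union> ?u" using assms(4) linorder_cases[of _ d] by blast
  moreover have "set_encode ({i\<in>v. i < d} \<union> ?u) = set_encode {i\<in>v. i < d} + set_encode ?u"
    using assms(1) by (intro set_encode_disjoint_Un) auto
  ultimately have "set_encode v = set_encode {i\<in>v. i < d} + set_encode ?u" by simp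
  also have "\<dots> < 2 ^ d + set_encode ?u" using set_encode_less_power[of "{i\<in>v. i < d}" d] by auto
  also have "\<dots> = set_encode (insert d ?u)" using assms(1) by simp
  also have "\<dots> \<le> set_encode w" using assms by (intro set_encode_mono) auto
  finally show ?thesis .
qed

lemma set_encode_lessE:
  assumes "finite v" "finite w" "set_encode v < set_encode w"
  obtains d where "d \<in> w" "d \<notin> v" "\<And>i. i > d \<Longrightarrow> i \<in> v \<longleftrightarrow> i \<in> w"
proof -
  let ?D = "(v - w) \<union> (w - v)"
  have fin: "finite ?D" and ne: "?D \<noteq> {}" using assms by auto
  define d where "d = Max ?D"
  have d: "d \<in> ?D" unfolding d_def using Max_in[OF fin ne] .
  have ag: "i \<in> v \<longleftrightarrow> i \<in> w" if "i > d" for i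
    using Max_ge[OF fin, of i] that unfolding d_def by auto
  have "d \<notin> v - w" using set_encode_less[of w v d] assms ag by auto
  then show ?thesis using d ag by (intro that[of d]) auto
qed

section \<open>A numerical key for the simplicial order\<close>

definition simplicial_key :: "nat \<Rightarrow> nat set \<Rightarrow> int" where
  "simplicial_key N X = 2 ^ N * int (card X) - int (set_encode X)"
  \<comment> \<open>injective on subsets of \<open>{..<N}\<close> only; additive, so the order restricts to the sections of the cube\<close>

lemma simplicial_key_insert:
  "finite X \<Longrightarrow> i \<notin> X \<Longrightarrow> simplicial_key N (insert i X) = simplicial_key N X + (2 ^ N - 2 ^ i)"
  by (simp add: simplicial_key_def algebra_simps)

text \<open>One more element adds \<open>2 ^ N\<close>, which exceeds anything the binary value of
  \<open>Y\<close> can subtract, so size dominates the order.\<close>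

lemma simplicial_key_less_card:
  assumes "Y \<subseteq> {..<N}" "card X < card Y"
  shows "simplicial_key N X < simplicial_key N Y"
proof -
  have "(2::int) ^ N * int (card X) + 2 ^ N \<le> 2 ^ N * int (card Y)"
  proof -
    have "(2::int) ^ N * (int (card X) + 1) \<le> 2 ^ N * int (card Y)"
      using assms(2) by (intro mult_left_mono) auto
    then show ?thesis by (simp add: algebra_simps)
  qed
  moreover have "int (set_encode Y) < 2 ^ N"
    using set_encode_less_power[OF assms(1)] by (metis of_nat_less_iff of_nat_numeral of_nat_power)
  ultimately show ?thesis unfolding simplicial_key_def by linarith
qed

lemma simplicial_key_le_cardD:
  "X \<subseteq> {..<N} \<Longrightarrow> simplicial_key N X \<le> simplicial_key N Y \<Longrightarrow> card X \<le> card Y"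
  using simplicial_key_less_card[of X N Y] by linarith

lemma simplicial_key_less_same_card:
  "card X = card Y \<Longrightarrow> simplicial_key N X < simplicial_key N Y \<longleftrightarrow> set_encode Y < set_encode X"
  by (simp add: simplicial_key_def)

lemma simplicial_key_less_top:
  assumes "finite X" "card X = card Y" "M \<in> X" "Y \<subseteq> {..<M}"
  shows "simplicial_key N X < simplicial_key N Y"
  using assms simplicial_key_less_same_card set_encode_less_power power_le_set_encode
  by (metis order_less_le_trans)

lemma inj_on_simplicial_key: "inj_on (simplicial_key N) (Pow {..<N})"
proof (rule inj_onI)
  fix X Y assume *: "X \<in> Pow {..<N}" "Y \<in> Pow {..<N}" "simplicial_key N X = simplicial_key N Y"
  then have fin: "finite X" "finite Y" using finite_subset by auto
  have "card X = card Y" using * simplicial_key_le_cardD by (metis PowD antisym order_refl)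
  then have "set_encode X = set_encode Y" using *(3) by (simp add: simplicial_key_def)
  then show "X = Y" using fin by (simp add: set_encode_eq)
qed

lemma inj_on_simplicial_key_subset:
  "S \<subseteq> {..<N} \<Longrightarrow> inj_on (simplicial_key N) (Pow S)"
  using inj_on_simplicial_key by (rule inj_on_subset) auto

section \<open>Neighbourhoods in the cube, and why those of initial segments are initial\<close>

definition cube_nbhd :: "'a set \<Rightarrow> 'a set set \<Rightarrow> 'a set set" where
  "cube_nbhd S A = {Y. Y \<subseteq> S \<and> (\<exists>X\<in>A. \<exists>i. X - {i} = Y - {i})}"
  \<comment> \<open>the closed neighbourhood in the cube \<open>Pow S\<close>\<close>

lemma cube_nbhd_mono: "A \<subseteq> B \<Longrightarrow> cube_nbhd S A \<subseteq> cube_nbhd S B"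
  unfolding cube_nbhd_def by blast

lemma cube_nbhd_subset: "cube_nbhd S A \<subseteq> Pow S"
  unfolding cube_nbhd_def by blast

lemma subset_cube_nbhd: "A \<subseteq> Pow S \<Longrightarrow> A \<subseteq> cube_nbhd S A"
  unfolding cube_nbhd_def by blast

lemma cube_nbhd_Un: "cube_nbhd S (A \<union> B) = cube_nbhd S A \<union> cube_nbhd S B"
  unfolding cube_nbhd_def by blast

lemma cube_nbhd_insertI: "X \<in> A \<Longrightarrow> insert i X \<subseteq> S \<Longrightarrow> insert i X \<in> cube_nbhd S A"
  unfolding cube_nbhd_def by (auto intro!: bexI[of _ X] exI[of _ i])

lemma cube_nbhd_removeI: "X \<in> A \<Longrightarrow> X \<subseteq> S \<Longrightarrow> X - {i} \<in> cube_nbhd S A"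
  unfolding cube_nbhd_def by (auto intro!: bexI[of _ X] exI[of _ i])

lemma cube_nbhdE:
  assumes "Y \<in> cube_nbhd S A"
  obtains "Y \<in> A" | X i where "X \<in> A" "i \<notin> X" "Y = insert i X" | X i where "X \<in> A" "i \<in> X" "Y = X - {i}"
proof -
  obtain X i where X: "X \<in> A" "X - {i} = Y - {i}" using assms unfolding cube_nbhd_def by auto
  consider "X = Y" | "i \<notin> X" "Y = insert i X" | "i \<in> X" "Y = X - {i}" using X(2) by blast
  then show thesis using X(1) that by cases blast+
qed

text \<open>Suppose removal reversed the order, with \<open>d\<close> the top difference. The
  reduced sets have equal size, so the reduced \<open>v\<close> has an element below
  \<open>d\<close> that the reduced \<open>w\<close> lacks; hence \<open>Min v < d\<close>, and
  restoring the minima cannot undo the difference at \<open>d\<close>.\<close>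

lemma set_encode_remove_Min_mono:
  assumes "finite v" "finite w" "card v = card w" "set_encode w \<le> set_encode v"
  shows "set_encode (w - {Min w}) \<le> set_encode (v - {Min v})"
proof (rule ccontr)
  let ?v = "v - {Min v}" and ?w = "w - {Min w}"
  assume "\<not> ?thesis"
  then obtain d where d: "d \<in> ?w" "d \<notin> ?v" "\<And>i. i > d \<Longrightarrow> i \<in> ?v \<longleftrightarrow> i \<in> ?w"
    using set_encode_lessE[of ?v ?w] assms by auto
  have "v \<noteq> {}" "w \<noteq> {}" using d assms by auto
  then have "card ?v = card ?w" using assms by simp
  then have "\<not> ?v \<subseteq> ?w" using d(1,2) assms(2) card_subset_eq[of ?w ?v] by auto
  then obtain e where e: "e \<in> ?v" "e \<notin> ?w" by blast
  then have "e < d" using d by (metis linorder_cases)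
  moreover have "Min v \<le> e" using e assms(1) by simp
  ultimately have "Min v < d" by simp
  then have "set_encode v < set_encode w"
    using d assms by (intro set_encode_less[of v w d]) auto
  with assms(4) show False by simp
qed

lemma set_encode_remove_le_Min:
  assumes "finite w" "i \<in> w"
  shows "set_encode (w - {i}) \<le> set_encode (w - {Min w})"
proof -
  have 1: "set_encode w = set_encode (w - {j}) + 2 ^ j" if "j \<in> w" for j
    using assms(1) that set_encode_insert[of "w - {j}" j] by (simp add: insert_absorb)
  have "(2::nat) ^ Min w \<le> 2 ^ i" using assms by (intro power_increasing) auto
  moreover have "Min w \<in> w" using assms by (intro Min_in) auto
  ultimately show ?thesis using 1[OF assms(2)] 1[of "Min w"] by linarith
qed

text \<open>This nestedness is what lets Harper's theorem be iterated. If \<open>w\<close> arises by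
  adding an element to some \<open>X\<close> in \<open>I\<close> and \<open>v\<close> comes no later
  than \<open>w\<close>, then \<open>v\<close> without its minimum comes no later than
  \<open>X\<close>, so it lies in \<open>I\<close> and has \<open>v\<close> as a neighbour.\<close>

lemma initial_segment_cube_nbhd:
  assumes S: "S \<subseteq> {..<N}" and I: "initial_segment (simplicial_key N) (Pow S) I"
  shows "initial_segment (simplicial_key N) (Pow S) (cube_nbhd S I)"
proof -
  let ?k = "simplicial_key N"
  have IS: "I \<subseteq> Pow S" using I by (simp add: initial_segment_def)
  have finS: "finite X" if "X \<subseteq> S" for X using that S by (meson finite_lessThan finite_subset order_trans)
  note dn = initial_segment_memI[OF I inj_on_simplicial_key_subset[OF S]]
  have "v \<in> cube_nbhd S I" if w: "w \<in> cube_nbhd S I" and v: "v \<subseteq> S" and le: "?k v \<le> ?k w" for v w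
    using w
  proof (cases rule: cube_nbhdE)
    case 1
    then show ?thesis using dn[of w v] v le subset_cube_nbhd[OF IS] by auto
  next
    \<comment> \<open>A set obtained by removing an element precedes \<open>X\<close>, hence so does
      \<open>v\<close>, and \<open>v\<close> is in \<open>I\<close> itself.\<close>
    case (3 X i)
    then have XS: "X \<subseteq> S" "w \<subseteq> S" using IS by auto
    then have "card w < card X" using 3 finS by (metis card_Diff1_less)
    then have "?k w < ?k X" using XS S by (intro simplicial_key_less_card) auto
    then show ?thesis using dn[of X v] v le subset_cube_nbhd[OF IS] 3 by auto
  next
    case (2 X i)
    have XS: "X \<subseteq> S" "w \<subseteq> S" using IS 2 w cube_nbhd_subset[of S I] by blast+
    show ?thesis
    proof (cases "v = {}")
      \<comment> \<open>The empty set has no minimum to remove, but it comes first in the order and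
        so lies in \<open>I\<close>.\<close>
      case True
      have "?k {} \<le> ?k X"
        using simplicial_key_less_card[of X N "{}"] order_trans[OF XS(1) S] finS[OF XS(1)]
        by (cases "X = {}") (simp_all add: card_gt_0_iff)
      then show ?thesis using dn[of X "{}"] 2(1) True subset_cube_nbhd[OF IS] by auto
    next
      case False
      have fv: "finite v" and fw: "finite w" using v XS finS by auto
      let ?v = "v - {Min v}"
      have mv: "Min v \<in> v" using fv False by simp
      have cv: "Suc (card ?v) = card v" using fv mv by (metis card_Suc_Diff1)
      have cX: "Suc (card X) = card w" using 2 XS finS by simp
      have cvw: "card v \<le> card w" using v S le by (intro simplicial_key_le_cardD) auto
      \<comment> \<open>For equal sizes compare through \<open>w - {Min w}\<close>: it comes no
        earlier than \<open>?v\<close>, and no later than \<open>X = w - {i}\<close>, because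
        removing the minimum loses the least binary value.\<close>
      have "?k ?v \<le> ?k X"
      proof (cases "card v = card w")
        case True
        then have "set_encode w \<le> set_encode v" using le by (simp add: simplicial_key_def)
        then have "set_encode (w - {Min w}) \<le> set_encode ?v"
          using fv fw True by (intro set_encode_remove_Min_mono) auto
        moreover have "set_encode X \<le> set_encode (w - {Min w})"
          using set_encode_remove_le_Min[OF fw, of i] 2 by simp
        moreover have "card ?v = card X" using True cv cX by linarith
        ultimately show ?thesis by (simp add: simplicial_key_def)
      next
        case False
        then have "card ?v < card X" using cvw cv cX by simp
        then show ?thesis using simplicial_key_less_card[of X N ?v] order_trans[OF XS(1) S] by simp
      qed
      then have "?v \<in> I" using dn[of X ?v] 2 v by auto
      then have "insert (Min v) ?v \<in> cube_nbhd S I" using v mv by (intro cube_nbhd_insertI) auto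
      then show ?thesis using mv by (simp add: insert_absorb)
    qed
  qed
  then show ?thesis
    unfolding initial_segment_def using cube_nbhd_subset[of S I]
    by (meson DiffD1 DiffD2 PowD linear)
qed

section \<open>Harper's theorem by compression\<close>

text \<open>\<open>P\<close> and \<open>Q\<close> are meant as the two sections of a family in
  direction \<open>i\<close>. Both live in the cube on \<open>S - {i}\<close>, where the induction
  hypothesis applies.\<close>

definition glue_sections :: "'a \<Rightarrow> 'a set set \<Rightarrow> 'a set set \<Rightarrow> 'a set set" where
  "glue_sections i P Q = P \<union> insert i ` Q"

lemma glue_sections_exists:
  assumes "A \<subseteq> Pow S"
  obtains P Q where "P \<subseteq> Pow (S - {i})" "Q \<subseteq> Pow (S - {i})" "A = glue_sections i P Q"
proof
  let ?P = "{X\<in>A. i \<notin> X}" and ?Q = "(\<lambda>X. X - {i}) ` {X\<in>A. i \<in> X}"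
  show "?P \<subseteq> Pow (S - {i})" "?Q \<subseteq> Pow (S - {i})" using assms by auto
  have "insert i ` ?Q = {X\<in>A. i \<in> X}" by (auto simp: image_image insert_absorb)
  then show "A = glue_sections i ?P ?Q" unfolding glue_sections_def by auto
qed

context
  fixes S :: "'a set" and i :: 'a and P Q :: "'a set set"
  assumes i: "i \<in> S" and PQ: "P \<subseteq> Pow (S - {i})" "Q \<subseteq> Pow (S - {i})"
begin

lemma insert_section_disjoint: "P \<inter> insert i ` Q = {}"
  using PQ by auto

lemma inj_on_insert_section: "inj_on (insert i) Q"
  using PQ(2) by (intro inj_onI) (metis Diff_insert_absorb PowD insertI1 Diff_iff subsetD)

lemma glue_sections_subset: "glue_sections i P Q \<subseteq> Pow S"
  using PQ i by (auto simp: glue_sections_def)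

lemma card_glue_sections: "finite S \<Longrightarrow> card (glue_sections i P Q) = card P + card Q"
  unfolding glue_sections_def using insert_section_disjoint inj_on_insert_section PQ
  by (subst card_Un_disjoint) (auto simp: card_image intro: finite_subset[of _ "Pow (S - {i})"])

lemma mem_glue_sections:
  "X \<in> glue_sections i P Q \<longleftrightarrow> (if i \<in> X then X - {i} \<in> Q else X \<in> P)"
proof (cases "i \<in> X")
  case True
  then have "X = insert i (X - {i})" by blast
  moreover have "Y - {i} = Y" if "Y \<in> Q" for Y using that PQ(2) by auto
  moreover have "X \<notin> P" using True PQ by auto
  ultimately show ?thesis using True by (auto simp: glue_sections_def)
qed (auto simp: glue_sections_def)

end

text \<open>A step in a direction other than \<open>i\<close> stays within its section, and a step
  in direction \<open>i\<close> copies a set into the other section.\<close>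

lemma cube_nbhd_glue_sections:
  assumes i: "i \<in> S" and PQ: "P \<subseteq> Pow (S - {i})" "Q \<subseteq> Pow (S - {i})"
  shows "cube_nbhd S (glue_sections i P Q) =
    glue_sections i (cube_nbhd (S - {i}) P \<union> Q) (cube_nbhd (S - {i}) Q \<union> P)"
proof (rule set_eqI)
  fix Y
  let ?T = "S - {i}"
  have sub: "cube_nbhd ?T P \<union> Q \<subseteq> Pow ?T" "cube_nbhd ?T Q \<union> P \<subseteq> Pow ?T"
    using PQ cube_nbhd_subset[of ?T P] cube_nbhd_subset[of ?T Q] by blast+
  have iP: "i \<notin> X" if "X \<in> P \<or> X \<in> Q" for X using that PQ by auto
  have L: "Y \<in> cube_nbhd S (glue_sections i P Q) \<longleftrightarrow>
     Y \<subseteq> S \<and> ((\<exists>X\<in>P. \<exists>j. X - {j} = Y - {j}) \<or> (\<exists>X\<in>Q. \<exists>j. insert i X - {j} = Y - {j}))"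
    unfolding cube_nbhd_def glue_sections_def by blast
  show "Y \<in> cube_nbhd S (glue_sections i P Q) \<longleftrightarrow>
      Y \<in> glue_sections i (cube_nbhd ?T P \<union> Q) (cube_nbhd ?T Q \<union> P)"
  proof (cases "i \<in> Y")
    case False
    have "(\<exists>j. insert i X - {j} = Y - {j}) \<longleftrightarrow> X = Y" if "X \<in> Q" for X
      using False iP[of X] that by blast
    moreover have "Y \<subseteq> S \<longleftrightarrow> Y \<subseteq> ?T" using False by blast
    ultimately show ?thesis
      unfolding mem_glue_sections[OF i sub] L using False PQ by (auto simp: cube_nbhd_def)
  next
    case True
    have 1: "(\<exists>j. X - {j} = Y - {j}) \<longleftrightarrow> X = Y - {i}" if "X \<in> P" for X
      using True iP[of X] that by blast
    have 2: "(\<exists>j. insert i X - {j} = Y - {j}) \<longleftrightarrow> (\<exists>j. X - {j} = Y - {i} - {j})" if "X \<in> Q" for X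
    proof
      assume "\<exists>j. insert i X - {j} = Y - {j}"
      then obtain j where "insert i X - {j} = Y - {j}" ..
      then have "X - {j} = Y - {i} - {j}" using iP[of X] that by blast
      then show "\<exists>j. X - {j} = Y - {i} - {j}" ..
    next
      assume "\<exists>j. X - {j} = Y - {i} - {j}"
      then obtain j where j: "X - {j} = Y - {i} - {j}" ..
      show "\<exists>j. insert i X - {j} = Y - {j}"
      proof (cases "j = i")
        case True
        then show ?thesis using j by (intro exI[of _ i]) blast
      next
        case False
        then have "insert i X - {j} = Y - {j}" using j \<open>i \<in> Y\<close> by blast
        then show ?thesis ..
      qed
    qed
    have "Y \<subseteq> S \<longleftrightarrow> Y - {i} \<subseteq> ?T" using i by blast
    then show ?thesis
      unfolding mem_glue_sections[OF i sub] L using True PQ 1 2 by (auto simp: cube_nbhd_def)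
  qed
qed

text \<open>The last summand depends on \<open>Q\<close> only through its size, which compression
  preserves, so the sum drops as soon as it drops on one section and grows on neither.\<close>

lemma sum_simplicial_key_glue_sections:
  assumes i: "i \<in> S" and fin: "finite S" and PQ: "P \<subseteq> Pow (S - {i})" "Q \<subseteq> Pow (S - {i})"
  shows "sum (simplicial_key N) (glue_sections i P Q) =
    sum (simplicial_key N) P + sum (simplicial_key N) Q + int (card Q) * (2 ^ N - 2 ^ i)"
proof -
  have f: "finite P" "finite Q" using PQ fin finite_subset by (metis finite_Diff finite_Pow_iff)+
  have "sum (simplicial_key N) (insert i ` Q) = (\<Sum>X\<in>Q. simplicial_key N (insert i X))"
    by (simp add: sum.reindex[OF inj_on_insert_section[OF i PQ]])
  also have "\<dots> = (\<Sum>X\<in>Q. simplicial_key N X + (2 ^ N - 2 ^ i))"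
  proof (rule sum.cong)
    fix X assume "X \<in> Q"
    then have "X \<subseteq> S - {i}" using PQ by blast
    then show "simplicial_key N (insert i X) = simplicial_key N X + (2 ^ N - 2 ^ i)"
      using fin by (intro simplicial_key_insert) (auto dest: finite_subset)
  qed simp
  also have "\<dots> = sum (simplicial_key N) Q + int (card Q) * (2 ^ N - 2 ^ i)"
    by (simp add: sum.distrib)
  finally show ?thesis
    unfolding glue_sections_def using f insert_section_disjoint[OF i PQ]
    by (subst sum.union_disjoint) auto
qed

section \<open>The configuration that compression alone cannot remove\<close>

text \<open>
  A family all of whose sections are initial segments can fail to be one only by containing \<open>y\<close>
  instead of its predecessor \<open>x\<close>, where \<open>y = S - x\<close>. If \<open>Min S \<in> x\<close>, then \<open>x\<close> adds nothing to the
  neighbourhood of the smaller sets; otherwise the cube has dimension at most 2.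
\<close>

lemma consecutive_complements:
  assumes S: "S \<subseteq> {..<N}" and x: "x \<subseteq> S" and y: "y = S - x" and s: "s \<in> S" "\<And>i. i \<in> S \<Longrightarrow> s \<le> i"
    and sx: "s \<notin> x"
    and less: "simplicial_key N x < simplicial_key N y"
    and consec: "\<And>z. z \<subseteq> S \<Longrightarrow> simplicial_key N x < simplicial_key N z \<Longrightarrow>
      simplicial_key N y \<le> simplicial_key N z"
  shows "S = {s} \<or> (\<exists>M. x = {M} \<and> y = {s})"
proof (cases "x = {}")
  case True
  \<comment> \<open>Here \<open>y = S\<close> is the immediate successor of the empty set, so it
    comes no later than \<open>{s}\<close> and has at most one element.\<close>
  have "simplicial_key N {} < simplicial_key N {s}"
    using s S by (intro simplicial_key_less_card) auto
  then have "simplicial_key N S \<le> simplicial_key N {s}"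
    using consec[of "{s}"] True y s by simp
  then have "card S \<le> 1" using simplicial_key_le_cardD[OF S] by fastforce
  moreover have "finite S" using S finite_subset by blast
  ultimately have "S = {s}" using s(1) card_le_Suc0_iff_eq[of S] by auto
  then show ?thesis ..
next
  case False
  let ?k = "simplicial_key N"
  have fin: "finite S" "finite x" "finite y" using S x y finite_subset by (auto intro: finite_subset)
  define m where "m = Min x"
  have m: "m \<in> x" "\<And>i. i \<in> x \<Longrightarrow> m \<le> i" using False fin by (auto simp: m_def)
  have sm: "s < m" using s(2) m(1) x sx by (metis le_neq_implies_less subsetD)
  define z where "z = insert s (x - {m})"
  have zS: "z \<subseteq> S" using x s by (auto simp: z_def)
  have ez: "set_encode z < set_encode x"
    using fin sm m(1) by (intro set_encode_less[of _ _ m]) (auto simp: z_def)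
  have cz: "card z = card x" using fin m(1) sx card_Suc_Diff1[of x m] by (simp add: z_def del: card_Diff_insert)
  have xz: "?k x < ?k z" using ez cz by (simp add: simplicial_key_def)
  then have yz: "?k y \<le> ?k z" using consec zS by blast
  moreover have "x \<subseteq> {..<N}" "y \<subseteq> {..<N}" using S x y by auto
  ultimately have cyx: "card y = card x"
    using simplicial_key_le_cardD[of y N z] simplicial_key_le_cardD[of x N y] cz less by simp
  define M where "M = Max S"
  have M: "M \<in> S" "\<And>i. i \<in> S \<Longrightarrow> i \<le> M" using s(1) fin(1) by (auto simp: M_def intro!: Max_in)
  \<comment> \<open>At equal size the set that contains \<open>Max S\<close> comes first.\<close>
  have Mx: "M \<in> x"
  proof (rule ccontr)
    assume nM: "M \<notin> x"
    have "x \<subseteq> {..<M}"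
    proof
      fix i assume "i \<in> x"
      then show "i \<in> {..<M}" using M(2)[of i] x nM by (cases "i = M") auto
    qed
    then have "?k y < ?k x" using nM M y fin cyx by (intro simplicial_key_less_top[of _ _ M]) auto
    then show False using less by simp
  qed
  \<comment> \<open>Otherwise \<open>z\<close> would keep \<open>M\<close> and precede
    \<open>y\<close>. The least element of \<open>x\<close> is thus the greatest of
    \<open>S\<close>, which makes \<open>x\<close> a singleton.\<close>
  have "m = M"
  proof (rule ccontr)
    assume "m \<noteq> M"
    have "y \<subseteq> {..<M}"
    proof
      fix i assume "i \<in> y"
      then show "i \<in> {..<M}" using M(2)[of i] Mx y by (cases "i = M") auto
    qed
    then have "?k z < ?k y"
      using Mx \<open>m \<noteq> M\<close> fin cyx cz by (intro simplicial_key_less_top[of _ _ M]) (auto simp: z_def)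
    then show False using yz by simp
  qed
  have xM: "x = {M}"
  proof
    show "x \<subseteq> {M}"
    proof
      fix i assume "i \<in> x"
      then have "M \<le> i" "i \<le> M" using m(2)[of i] M(2)[of i] x \<open>m = M\<close> by auto
      then show "i \<in> {M}" by simp
    qed
  qed (use Mx in simp)
  have "s \<in> y" using s sx y by simp
  then have "y = {s}" using cyx xM card_le_Suc0_iff_eq[of y] fin by auto
  then show ?thesis using xM by blast
qed

lemma card_cube_nbhd_consecutive_complements:
  assumes S: "S \<subseteq> {..<N}" and x: "x \<subseteq> S" and y: "y = S - x"
    and less: "simplicial_key N x < simplicial_key N y"
    and consec: "\<And>z. z \<subseteq> S \<Longrightarrow> simplicial_key N x < simplicial_key N z \<Longrightarrow>
      simplicial_key N y \<le> simplicial_key N z"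
  defines "B \<equiv> {z. z \<subseteq> S \<and> simplicial_key N z < simplicial_key N x}"
  shows "card (cube_nbhd S (insert x B)) \<le> card (cube_nbhd S (insert y B))"
proof -
  let ?k = "simplicial_key N"
  have fin: "finite S" "finite x" using S x finite_subset by (auto intro: finite_subset)
  then have finN: "finite (cube_nbhd S A)" for A
    using finite_subset[OF cube_nbhd_subset[of S A]] by simp
  have xy: "x \<noteq> y" using less by auto
  then have "S \<noteq> {}" using x y by auto
  define s where "s = Min S"
  have s: "s \<in> S" "\<And>i. i \<in> S \<Longrightarrow> s \<le> i" using fin \<open>S \<noteq> {}\<close> by (auto simp: s_def)
  have BS: "B \<subseteq> Pow S" by (auto simp: B_def)
  show ?thesis
  proof (cases "s \<in> x")
    case True
    have rem: "x - {j} \<in> B" if "j \<in> x" for j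
    proof -
      have "card (x - {j}) < card x" using that fin by (meson card_Diff1_less)
      then show ?thesis using simplicial_key_less_card[of x N "x - {j}"] x S by (auto simp: B_def)
    qed
    \<comment> \<open>\<open>x\<close> is reached from \<open>x - {s}\<close>; a larger neighbour is
      reached by adding \<open>s\<close> to \<open>insert j (x - {s})\<close>, which precedes
      \<open>x\<close> because \<open>s < j\<close>; a smaller neighbour is itself in
      \<open>B\<close>.\<close>
    have "w \<in> cube_nbhd S B" if w: "w \<in> cube_nbhd S {x}" for w
      using w
    proof (cases rule: cube_nbhdE)
      case 1
      then have "w = insert s (x - {s})" using True by auto
      then show ?thesis using cube_nbhd_insertI[OF rem[OF True], of s S] x True by auto
    next
      case (2 X j)
      have jS: "j \<in> S" "j \<notin> x" using w 2 cube_nbhd_subset[of S "{x}"] by auto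
      then have "s < j" using s(2)[of j] True by (metis le_neq_implies_less)
      then have e: "set_encode x < set_encode (insert j (x - {s}))"
        using fin jS by (intro set_encode_less[of _ _ j]) auto
      have "card (insert j (x - {s})) = card x"
        using fin jS True card_Suc_Diff1[of x s] by simp
      then have "?k (insert j (x - {s})) < ?k x" using e by (simp add: simplicial_key_def)
      then have "insert j (x - {s}) \<in> B" using jS x by (auto simp: B_def)
      moreover have "insert s (insert j (x - {s})) = w" using True 2 by auto
      ultimately show ?thesis using cube_nbhd_insertI[of "insert j (x - {s})" B s S] x jS True by auto
    next
      case (3 X j)
      then show ?thesis using rem[of j] subset_cube_nbhd[OF BS] by auto
    qed
    then have "cube_nbhd S (insert x B) \<subseteq> cube_nbhd S (insert y B)"
      using cube_nbhd_Un[of S "{x}" B] cube_nbhd_mono[of B "insert y B" S] by auto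
    then show ?thesis using finN by (intro card_mono)
  next
    case False
    have "S = {s} \<or> (\<exists>M. x = {M} \<and> y = {s})"
      by (rule consecutive_complements[OF S x y]) (use s False less consec in auto)
    \<comment> \<open>In these small cubes \<open>insert y B\<close> already reaches everything, so
      the inequality is trivial.\<close>
    then have "cube_nbhd S (insert y B) = Pow S"
    proof (elim disjE exE conjE)
      assume "S = {s}"
      then have "y = {s}" using y False x by auto
      then have "{s} \<in> cube_nbhd S (insert y B)" "{} \<in> cube_nbhd S (insert y B)"
        using cube_nbhd_removeI[of y "insert y B" S s] cube_nbhd_insertI[of y "insert y B" s S] \<open>S = {s}\<close> by auto
      then show ?thesis using \<open>S = {s}\<close> cube_nbhd_subset[of S "insert y B"] by (auto simp: subset_singleton_iff)
    next
      fix M assume M: "x = {M}" "y = {s}"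
      then have SM: "S = {s, M}" using x y by auto
      have "?k {} < ?k x" using M x S by (intro simplicial_key_less_card) auto
      then have mem: "{} \<in> insert y B" "{s} \<in> insert y B" using M by (auto simp: B_def)
      have "{s} \<in> cube_nbhd S (insert y B)" "{} \<in> cube_nbhd S (insert y B)"
        using mem SM unfolding cube_nbhd_def by blast+
      moreover have "{M} \<in> cube_nbhd S (insert y B)" "{M, s} \<in> cube_nbhd S (insert y B)"
        using cube_nbhd_insertI[OF mem(1), of M S] cube_nbhd_insertI[OF mem(2), of M S] SM by auto
      moreover have "Pow S = {{}, {s}, {M}, {M, s}}" using SM by blast
      ultimately show ?thesis using cube_nbhd_subset[of S "insert y B"] by auto
    qed
    then show ?thesis using cube_nbhd_subset[of S "insert x B"] fin by (auto intro: card_mono)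
  qed
qed

text \<open>If \<open>x\<close> and \<open>y\<close> agreed on \<open>i\<close>, they would lie in
  the same section. Dropping \<open>i\<close> from both preserves their order, so a section that is
  initial and contains \<open>y\<close> would also contain \<open>x\<close>.\<close>

lemma initial_sections_opposite:
  assumes S: "S \<subseteq> {..<N}" and A: "A \<subseteq> Pow S"
    and sections: "\<And>i P Q. i \<in> S \<Longrightarrow> P \<subseteq> Pow (S - {i}) \<Longrightarrow> Q \<subseteq> Pow (S - {i}) \<Longrightarrow> A = glue_sections i P Q \<Longrightarrow>
      initial_segment (simplicial_key N) (Pow (S - {i})) P \<and> initial_segment (simplicial_key N) (Pow (S - {i})) Q"
    and xy: "x \<subseteq> S" "x \<notin> A" "y \<in> A" "simplicial_key N x < simplicial_key N y"
  shows "y = S - x"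
proof -
  let ?k = "simplicial_key N"
  have yS: "y \<subseteq> S" using xy A by auto
  have fin: "finite x" "finite y" using S yS xy(1) by (auto intro: finite_subset)
  have "i \<in> x \<longleftrightarrow> i \<notin> y" if i: "i \<in> S" for i
  proof (rule ccontr)
    assume eq: "\<not> ?thesis"
    obtain P Q where PQ: "P \<subseteq> Pow (S - {i})" "Q \<subseteq> Pow (S - {i})" and APQ: "A = glue_sections i P Q"
      using glue_sections_exists[OF A] by blast
    note mem = mem_glue_sections[OF i PQ]
    have init: "initial_segment ?k (Pow (S - {i})) P" "initial_segment ?k (Pow (S - {i})) Q"
      using sections[OF i PQ APQ] by auto
    show False
    proof (cases "i \<in> x")
      case True
      then have iy: "i \<in> y" using eq by simp
      have "?k (x - {i}) < ?k (y - {i})"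
        using xy(4) simplicial_key_insert[of "x - {i}" i N] simplicial_key_insert[of "y - {i}" i N] fin True iy
        by (simp add: insert_absorb)
      moreover have "x - {i} \<notin> Q" "y - {i} \<in> Q" using xy(2,3) mem True iy unfolding APQ by auto
      moreover have "x - {i} \<in> Pow (S - {i})" using xy(1) by auto
      ultimately show False using init(2) unfolding initial_segment_def by (meson DiffI linorder_not_le)
    next
      case False
      then have iy: "i \<notin> y" using eq by simp
      then have "x \<notin> P" "y \<in> P" using xy(2,3) mem False unfolding APQ by auto
      moreover have "x \<in> Pow (S - {i})" using xy(1) False by auto
      ultimately show False using init(1) xy(4) unfolding initial_segment_def by (meson DiffI linorder_not_le)
    qed
  qed
  then show ?thesis using yS xy(1) by blast
qed

text \<open>\<open>B\<close> arises by replacing both sections by initial segments of the same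
  sizes. The neighbourhood splits into two unions, neither of which grows, and the key sum drops
  because at least one section has changed.\<close>

lemma compress_section:
  assumes S: "S \<subseteq> {..<N}" and i: "i \<in> S"
    and IH: "\<And>A I. A \<subseteq> Pow (S - {i}) \<Longrightarrow> initial_segment (simplicial_key N) (Pow (S - {i})) I \<Longrightarrow> card I = card A \<Longrightarrow>
       card (cube_nbhd (S - {i}) I) \<le> card (cube_nbhd (S - {i}) A)"
    and PQ: "P \<subseteq> Pow (S - {i})" "Q \<subseteq> Pow (S - {i})"
    and noninitial: "\<not> (initial_segment (simplicial_key N) (Pow (S - {i})) P \<and>
      initial_segment (simplicial_key N) (Pow (S - {i})) Q)"
  obtains B where "B \<subseteq> Pow S" "card B = card (glue_sections i P Q)"
    "card (cube_nbhd S B) \<le> card (cube_nbhd S (glue_sections i P Q))"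
    "sum (simplicial_key N) B < sum (simplicial_key N) (glue_sections i P Q)"
proof -
  let ?k = "simplicial_key N" and ?T = "S - {i}"
  have fin: "finite S" "finite (Pow ?T)" using S by (auto intro: finite_subset)
  have T: "?T \<subseteq> {..<N}" using S by auto
  note inj = inj_on_simplicial_key_subset[OF T]
  have fN: "finite (cube_nbhd ?T A)" for A using finite_subset[OF cube_nbhd_subset[of ?T A]] fin by simp

  obtain P' where P': "initial_segment ?k (Pow ?T) P'" "card P' = card P"
    using initial_segment_exists[OF fin(2) card_mono[OF fin(2) PQ(1)]] by blast
  obtain Q' where Q': "initial_segment ?k (Pow ?T) Q'" "card Q' = card Q"
    using initial_segment_exists[OF fin(2) card_mono[OF fin(2) PQ(2)]] by blast
  have PQ': "P' \<subseteq> Pow ?T" "Q' \<subseteq> Pow ?T" using P' Q' by (auto simp: initial_segment_def)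
  \<comment> \<open>The compressed parts are both initial segments, hence nested, and their union is
    just the larger one. Each of the two is at most the original union in size.\<close>
  have Un_le: "card (cube_nbhd ?T X' \<union> Y') \<le> card (cube_nbhd ?T X \<union> Y)"
    if X: "X \<subseteq> Pow ?T" "initial_segment ?k (Pow ?T) X'" "card X' = card X"
      and Y: "Y \<subseteq> Pow ?T" "initial_segment ?k (Pow ?T) Y'" "card Y' = card Y" for X X' Y Y'
  proof -
    have fU: "finite (cube_nbhd ?T X \<union> Y)" using fN finite_subset[OF Y(1) fin(2)] by simp
    have "cube_nbhd ?T X' \<union> Y' = cube_nbhd ?T X' \<or> cube_nbhd ?T X' \<union> Y' = Y'"
      using initial_segment_linear[OF initial_segment_cube_nbhd[OF T X(2)] Y(2) inj] by blast
    moreover have "card (cube_nbhd ?T X') \<le> card (cube_nbhd ?T X \<union> Y)"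
      using IH[OF X] card_mono[OF fU, of "cube_nbhd ?T X"] by simp
    moreover have "card Y' \<le> card (cube_nbhd ?T X \<union> Y)"
      using Y(3) card_mono[OF fU, of Y] by simp
    ultimately show ?thesis by metis
  qed
  have sub: "cube_nbhd ?T X \<union> Y \<subseteq> Pow ?T" if "Y \<subseteq> Pow ?T" for X Y
    using that cube_nbhd_subset[of ?T X] by blast
  let ?B = "glue_sections i P' Q'"
  have "card (cube_nbhd S ?B) \<le> card (cube_nbhd S (glue_sections i P Q))"
    unfolding cube_nbhd_glue_sections[OF i PQ] cube_nbhd_glue_sections[OF i PQ']
      card_glue_sections[OF i sub[OF PQ(2)] sub[OF PQ(1)] fin(1)]
      card_glue_sections[OF i sub[OF PQ'(2)] sub[OF PQ'(1)] fin(1)]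
    using Un_le[OF PQ(1) P' PQ(2) Q'] Un_le[OF PQ(2) Q' PQ(1) P'] by (rule add_mono)
  moreover have "sum ?k ?B < sum ?k (glue_sections i P Q)"
  proof -
    have le: "X = X' \<or> sum ?k X' < sum ?k X"
      if "X \<subseteq> Pow ?T" "initial_segment ?k (Pow ?T) X'" "card X' = card X" for X X'
      using initial_segment_sum_less[OF that(2) inj fin(2) that(1) that(3)[symmetric]] by blast
    have "P \<noteq> P' \<or> Q \<noteq> Q'" using noninitial P' Q' by auto
    then have "sum ?k P' + sum ?k Q' < sum ?k P + sum ?k Q"
      using le[OF PQ(1) P'] le[OF PQ(2) Q'] by auto
    then show ?thesis
      unfolding sum_simplicial_key_glue_sections[OF i fin(1) PQ] sum_simplicial_key_glue_sections[OF i fin(1) PQ']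
      using Q'(2) by simp
  qed
  moreover have "card ?B = card (glue_sections i P Q)"
    unfolding card_glue_sections[OF i PQ fin(1)] card_glue_sections[OF i PQ' fin(1)] using P' Q' by simp
  ultimately show thesis using that[of ?B] glue_sections_subset[OF i PQ'] by blast
qed

text \<open>A family with initial sections can violate the order only at a complementary pair. So
  \<open>A\<close> consists of everything before some \<open>x\<close>, together with its successor
  \<open>y = S - x\<close>. Exchanging \<open>y\<close> for \<open>x\<close> does not enlarge the
  neighbourhood but lowers the key sum, against minimality.\<close>

lemma initial_segment_minimizer:
  assumes S: "S \<subseteq> {..<N}" and A: "A \<subseteq> Pow S"
    and sections: "\<And>i P Q. i \<in> S \<Longrightarrow> P \<subseteq> Pow (S - {i}) \<Longrightarrow> Q \<subseteq> Pow (S - {i}) \<Longrightarrow> A = glue_sections i P Q \<Longrightarrow>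
      initial_segment (simplicial_key N) (Pow (S - {i})) P \<and> initial_segment (simplicial_key N) (Pow (S - {i})) Q"
    and minimal: "\<And>B. B \<subseteq> Pow S \<Longrightarrow> card B = card A \<Longrightarrow> card (cube_nbhd S B) \<le> card (cube_nbhd S A) \<Longrightarrow>
      sum (simplicial_key N) A \<le> sum (simplicial_key N) B"
  shows "initial_segment (simplicial_key N) (Pow S) A"
proof (rule ccontr)
  let ?k = "simplicial_key N"
  assume "\<not> ?thesis"
  then obtain x y where xy: "x \<subseteq> S" "x \<notin> A" "y \<in> A" "?k x < ?k y"
    using A unfolding initial_segment_def by (meson DiffD1 DiffD2 PowD linorder_not_le)
  have opp: "v = S - u" if "u \<subseteq> S" "u \<notin> A" "v \<in> A" "?k u < ?k v" for u v
    by (rule initial_sections_opposite[OF S A]) (use sections that in auto)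
  have y: "y = S - x" using opp xy by blast
  let ?B = "{z. z \<subseteq> S \<and> ?k z < ?k x}"
  have inj: "u = v" if "u \<subseteq> S" "v \<subseteq> S" "?k u = ?k v" for u v
    using inj_on_simplicial_key_subset[OF S] that by (auto dest: inj_onD)
  \<comment> \<open>Complements are unique, so \<open>x\<close> is the only set before
    \<open>y\<close> missing from \<open>A\<close>; dually \<open>y\<close> is the only member of
    \<open>A\<close> after \<open>x\<close>.\<close>
  have lower: "z \<in> A" if "z \<subseteq> S" "?k z < ?k y" "z \<noteq> x" for z
  proof (rule ccontr)
    assume "z \<notin> A"
    then have "S - x = S - z" using opp[of z y] that xy(3) y by simp
    then show False using that xy(1) by blast
  qed
  have upper: "z \<notin> A" if "z \<subseteq> S" "?k x < ?k z" "z \<noteq> y" for z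
    using opp[of x z] that xy y by blast
  have consec: "?k y \<le> ?k z" if "z \<subseteq> S" "?k x < ?k z" for z
    using lower[of z] upper[of z] that by (metis linorder_not_le order_less_irrefl)
  have AB: "A = insert y ?B"
  proof
    show "insert y ?B \<subseteq> A" using lower xy by (auto intro: less_trans)
    show "A \<subseteq> insert y ?B"
    proof
      fix z assume z: "z \<in> A"
      then have "z \<noteq> x" "z \<subseteq> S" using xy(2) A by auto
      then have "?k z \<noteq> ?k x" using inj xy(1) by blast
      moreover have "z = y \<or> \<not> ?k x < ?k z" using z upper[of z] \<open>z \<subseteq> S\<close> by blast
      ultimately show "z \<in> insert y ?B" using \<open>z \<subseteq> S\<close> by (metis CollectI insertCI linorder_neqE)
    qed
  qed
  have "finite S" using S by (auto intro: finite_subset)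
  then have finB: "finite ?B" by simp
  have nB: "x \<notin> ?B" "y \<notin> ?B" using xy(4) by auto
  have "card (cube_nbhd S (insert x ?B)) \<le> card (cube_nbhd S A)"
    unfolding AB by (rule card_cube_nbhd_consecutive_complements[OF S xy(1) y xy(4)]) (use consec in auto)
  moreover have "insert x ?B \<subseteq> Pow S" using xy(1) by auto
  moreover have "card (insert x ?B) = card A" unfolding AB using finB nB by simp
  ultimately have "sum ?k A \<le> sum ?k (insert x ?B)" using minimal by blast
  then show False unfolding AB using finB nB xy(4) by simp
qed

text \<open>Induction over proper subsets supplies the claim on each \<open>S - {i}\<close>, where
  compression uses it. The minimiser \<open>C\<close> cannot be compressed, so its sections are
  initial and then so is \<open>C\<close>; comparing sizes gives
  \<open>I \<subseteq> C\<close>.\<close>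

lemma harper_vertex_isoperimetry:
  assumes "S \<subseteq> {..<N}" "A \<subseteq> Pow S" "initial_segment (simplicial_key N) (Pow S) I" "card I \<le> card A"
  shows "card (cube_nbhd S I) \<le> card (cube_nbhd S A)"
proof -
  have "finite S" using assms(1) finite_subset by blast
  then show ?thesis using assms
  proof (induction S arbitrary: A I rule: finite_psubset_induct)
    case (psubset S)
    let ?k = "simplicial_key N"
    note S = psubset.prems(1)
    define U where "U = {B. B \<subseteq> Pow S \<and> card B = card A}"
      \<comment> \<open>pick \<open>C \<in> U\<close> minimising first the size of the neighbourhood, then the sum of the keys\<close>
    have AU: "A \<in> U" using psubset.prems by (auto simp: U_def)
    have finU: "finite U" using psubset.hyps unfolding U_def
      by simp
    define V where "V = {B \<in> U. \<forall>C\<in>U. card (cube_nbhd S B) \<le> card (cube_nbhd S C)}"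
    have "arg_min_on (\<lambda>B. card (cube_nbhd S B)) U \<in> V"
      unfolding V_def using AU finU
      by (auto intro!: arg_min_if_finite(1) arg_min_least[where f = "\<lambda>B. card (cube_nbhd S B)"])
    then have V: "V \<noteq> {}" "finite V" using finU by (auto simp: V_def)
    define C where "C = arg_min_on (sum ?k) V"
    have CV: "C \<in> V" unfolding C_def using V by (intro arg_min_if_finite(1))
    have Cmin: "sum ?k C \<le> sum ?k B" if "B \<in> V" for B
      unfolding C_def using V that by (intro arg_min_least)
    have CS: "C \<subseteq> Pow S" "card C = card A" using CV by (auto simp: V_def U_def)
    have minimal: "sum ?k C \<le> sum ?k B"
      if "B \<subseteq> Pow S" "card B = card C" "card (cube_nbhd S B) \<le> card (cube_nbhd S C)" for B
      using that CV CS by (intro Cmin) (auto simp: V_def U_def intro: order_trans)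
    have "initial_segment ?k (Pow S) C"
    proof (rule initial_segment_minimizer[OF S CS(1)])
      fix i P Q
      assume i: "i \<in> S" and PQ: "P \<subseteq> Pow (S - {i})" "Q \<subseteq> Pow (S - {i})" and C: "C = glue_sections i P Q"
      show "initial_segment ?k (Pow (S - {i})) P \<and> initial_segment ?k (Pow (S - {i})) Q"
      proof (rule ccontr)
        assume non: "\<not> ?thesis"
        have IH: "card (cube_nbhd (S - {i}) I) \<le> card (cube_nbhd (S - {i}) A)"
          if "A \<subseteq> Pow (S - {i})" "initial_segment ?k (Pow (S - {i})) I" "card I = card A" for A I
          by (rule psubset.IH) (use i S that in auto)
        obtain B where "B \<subseteq> Pow S" "card B = card C" "card (cube_nbhd S B) \<le> card (cube_nbhd S C)"
          "sum ?k B < sum ?k C"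
          unfolding C by (rule compress_section[OF S i IH PQ non])
        then show False using minimal[of B] by simp
      qed
    qed (use minimal in auto)
    then have "I \<subseteq> C"
      using initial_segment_card_mono[OF psubset.prems(3)] inj_on_simplicial_key_subset[OF S] psubset CS by auto
    then have "card (cube_nbhd S I) \<le> card (cube_nbhd S C)"
      using psubset.hyps by (intro card_mono cube_nbhd_mono finite_subset[OF cube_nbhd_subset]) auto
    also have "\<dots> \<le> card (cube_nbhd S A)" using CV AU by (auto simp: V_def)
    finally show ?case .
  qed
qed

section \<open>Positions in the simplicial order\<close>

definition simplicial_rank :: "nat \<Rightarrow> nat set \<Rightarrow> nat" where
  "simplicial_rank n X = (\<Sum>j<n. \<Sum>k<card (X \<inter> {..j}). j choose k)"

lemma card_subsets_card_less:
  "card {Y. Y \<subseteq> {..<n} \<and> card Y < c} = (\<Sum>k<c. n choose k)"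
proof (induction c)
  case (Suc c)
  have "{Y. Y \<subseteq> {..<n} \<and> card Y < Suc c} =
      {Y. Y \<subseteq> {..<n} \<and> card Y < c} \<union> {Y. Y \<subseteq> {..<n} \<and> card Y = c}" by auto
  then have "card {Y. Y \<subseteq> {..<n} \<and> card Y < Suc c} =
      card {Y. Y \<subseteq> {..<n} \<and> card Y < c} + card {Y. Y \<subseteq> {..<n} \<and> card Y = c}"
    by (simp only:) (rule card_Un_disjoint, auto)
  then show ?case using Suc n_subsets[of "{..<n}" c] by simp
qed simp

text \<open>Split the sets before \<open>X\<close> by whether they agree with \<open>X\<close> at
  the top element \<open>n\<close>. Those that agree are counted by induction. Those that disagree
  correspond to the \<open>Y \<subseteq> {..<n}\<close> with \<open>card Y < card X\<close>: if
  \<open>n\<close> is in \<open>X\<close>, a \<open>Y\<close> of equal size loses the tie; if not,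
  \<open>insert n Y\<close> is one larger than \<open>Y\<close> but wins the tie.\<close>

lemma card_simplicial_less:
  assumes "X \<subseteq> {..<n}" "n \<le> N"
  shows "card {Y. Y \<subseteq> {..<n} \<and> simplicial_key N Y < simplicial_key N X} = simplicial_rank n X"
  using assms
proof (induction n arbitrary: X)
  case 0
  then show ?case by (simp add: simplicial_rank_def)
next
  case (Suc n)
  let ?k = "simplicial_key N"
  define X' where "X' = X \<inter> {..<n}"
  define E0 where "E0 = {Y. Y \<subseteq> {..<n} \<and> ?k Y < ?k X}"
  define E1 where "E1 = {Y. Y \<subseteq> {..<n} \<and> ?k (insert n Y) < ?k X}"
  let ?L = "{Y. Y \<subseteq> {..<n} \<and> ?k Y < ?k X'}"
  let ?C = "{Y. Y \<subseteq> {..<n} \<and> card Y < card X}"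
  have fX: "finite X" using Suc.prems finite_subset by auto
  have fY: "finite Y" if "Y \<subseteq> {..<n}" for Y using that finite_subset by auto
  have IH: "card ?L = simplicial_rank n X'" using Suc by (auto simp: X'_def)
  have XN: "X \<subseteq> {..<N}" using Suc.prems by auto
  have keyins: "?k (insert n Y) = ?k Y + (2 ^ N - 2 ^ n)" if "Y \<subseteq> {..<n}" for Y
    using that fY by (intro simplicial_key_insert) auto
  have "{Y. Y \<subseteq> {..<Suc n} \<and> ?k Y < ?k X} = E0 \<union> insert n ` E1"
  proof
    show "E0 \<union> insert n ` E1 \<subseteq> {Y. Y \<subseteq> {..<Suc n} \<and> ?k Y < ?k X}"
      by (auto simp: E0_def E1_def lessThan_Suc)
    show "{Y. Y \<subseteq> {..<Suc n} \<and> ?k Y < ?k X} \<subseteq> E0 \<union> insert n ` E1"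
    proof
      fix Y assume Y: "Y \<in> {Y. Y \<subseteq> {..<Suc n} \<and> ?k Y < ?k X}"
      show "Y \<in> E0 \<union> insert n ` E1"
      proof (cases "n \<in> Y")
        case True
        then have "Y = insert n (Y - {n})" "Y - {n} \<in> E1"
          using Y by (auto simp: E1_def lessThan_Suc insert_absorb)
        then show ?thesis by blast
      next
        case False
        then show ?thesis using Y by (auto simp: E0_def lessThan_Suc)
      qed
    qed
  qed
  moreover have "card (E0 \<union> insert n ` E1) = card E0 + card E1"
  proof -
    have "E0 \<inter> insert n ` E1 = {}" by (auto simp: E0_def)
    moreover have "inj_on (insert n) E1"
    proof (rule inj_onI)
      fix a b assume "a \<in> E1" "b \<in> E1" "insert n a = insert n b"
      moreover from this have "n \<notin> a" "n \<notin> b" by (auto simp: E1_def)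
      ultimately show "a = b" by (simp add: insert_ident)
    qed
    moreover have "finite E0" "finite E1" by (simp_all add: E0_def E1_def)
    ultimately show ?thesis by (simp add: card_Un_disjoint card_image)
  qed
  moreover have "card E0 + card E1 = card ?L + card ?C"
  proof (cases "n \<in> X")
    case True
    have X: "X = insert n X'" using True Suc.prems by (auto simp: X'_def lessThan_Suc)
    have "?k X = ?k X' + (2 ^ N - 2 ^ n)" using keyins[of X', folded X] by (simp add: X'_def)
    then have "E1 = ?L" using keyins by (auto simp: E1_def)
    moreover have "?k Y < ?k X \<longleftrightarrow> card Y < card X" if Y: "Y \<subseteq> {..<n}" for Y
    proof -
      have "Y \<subseteq> {..<N}" using Y Suc.prems by auto
      then show ?thesis
        using simplicial_key_less_card[OF XN, of Y] simplicial_key_less_card[of Y N X]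
          simplicial_key_less_top[OF fX _ True Y, of N] by (cases "card X" "card Y" rule: linorder_cases) auto
    qed
    then have "E0 = ?C" by (auto simp: E0_def)
    ultimately show ?thesis by simp
  next
    case False
    then have Xn: "X \<subseteq> {..<n}" using Suc.prems by (auto simp: lessThan_Suc)
    then have X: "X' = X" by (auto simp: X'_def)
    have "?k (insert n Y) < ?k X \<longleftrightarrow> card Y < card X" if Y: "Y \<subseteq> {..<n}" for Y
    proof -
      have "insert n Y \<subseteq> {..<N}" using Y Suc.prems by auto
      moreover have "card (insert n Y) = Suc (card Y)" using Y fY by (subst card_insert_disjoint) auto
      ultimately show ?thesis
        using simplicial_key_less_card[OF XN, of "insert n Y"] simplicial_key_less_card[of "insert n Y" N X]
          simplicial_key_less_top[of "insert n Y" X n N] Xn fY[OF Y]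
        by (cases "card X" "Suc (card Y)" rule: linorder_cases) auto
    qed
    then have "E1 = ?C" by (auto simp: E1_def)
    then show ?thesis by (simp add: E0_def X)
  qed
  moreover have "simplicial_rank (Suc n) X = simplicial_rank n X' + card ?C"
  proof -
    have "X' \<inter> {..j} = X \<inter> {..j}" if "j < n" for j using that by (auto simp: X'_def)
    moreover have "X \<inter> {..n} = X" using Suc.prems by auto
    ultimately show ?thesis by (simp add: simplicial_rank_def card_subsets_card_less)
  qed
  ultimately show ?case using IH by simp
qed

section \<open>Central windows in the rows of Pascal's triangle\<close>

definition binomial_window :: "nat \<Rightarrow> nat \<Rightarrow> nat \<Rightarrow> nat" where
  "binomial_window t j a = (\<Sum>k<t. j choose (a + k))"

text \<open>This start centres \<open>t\<close> consecutive entries in row \<open>j\<close>, up to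
  rounding. For \<open>j + 1 < t\<close> the truncated subtraction gives 0, and the window covers
  the whole row.\<close>

definition hamming_width :: "nat \<Rightarrow> nat \<Rightarrow> nat" where
  "hamming_width t n = (\<Sum>j<n. binomial_window t j ((j + 1 - t) div 2))"

text \<open>Rows are unimodal and \<open>b\<close> is at least as close to the middle as
  \<open>a\<close>; past the middle, \<open>b\<close> is reflected to \<open>j - b\<close>.\<close>

lemma binomial_le_of_add_le:
  assumes "a \<le> b" "a + b \<le> j"
  shows "j choose a \<le> j choose b"
proof (cases "2 * b \<le> j")
  case True
  then show ?thesis using assms binomial_mono[of a b j] by simp
next
  case False
  then have "j choose a \<le> j choose (j - b)" using assms by (intro binomial_mono) auto
  then show ?thesis using binomial_symmetric[of b j] assms by simp
qed

lemma binomial_le_of_le_add: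
  assumes "a \<le> b" "j \<le> a + b"
  shows "j choose b \<le> j choose a"
proof (cases "b \<le> j")
  case True
  then have "j choose (j - b) \<le> j choose (j - a)" using assms by (intro binomial_le_of_add_le) auto
  then show ?thesis using binomial_symmetric[of b j] binomial_symmetric[of a j] True assms by simp
qed (simp add: binomial_eq_0)

lemma binomial_window_Suc:
  "binomial_window t j (Suc a) + (j choose a) = binomial_window t j a + (j choose (a + t))"
proof -
  have "(\<Sum>k<Suc t. j choose (a + k)) = (j choose a) + (\<Sum>k<t. j choose (Suc a + k))"
    unfolding sum.lessThan_Suc_shift by simp
  then show ?thesis by (simp add: binomial_window_def)
qed

text \<open>Shifting a window by one trades \<open>j choose m\<close> for
  \<open>j choose (m + t)\<close>. Before the central start this never loses, from there on it never
  gains.\<close>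

lemma binomial_window_le_central:
  "binomial_window t j a \<le> binomial_window t j ((j + 1 - t) div 2)" (is "_ \<le> binomial_window t j ?s")
proof (cases "a \<le> ?s")
  case True
  then show ?thesis
  proof (induction rule: inc_induct)
    case (step m)
    then have "j choose m \<le> j choose (m + t)" by (intro binomial_le_of_add_le) auto
    then show ?case using step binomial_window_Suc[of t j m] by linarith
  qed simp
next
  case False
  then have "?s \<le> a" by simp
  then show ?thesis
  proof (induction rule: dec_induct)
    case (step m)
    then have "j choose (m + t) \<le> j choose m" by (intro binomial_le_of_le_add) auto
    then show ?case using step binomial_window_Suc[of t j m] by linarith
  qed simp
qed

lemma sum_binomial_add_window:
  "(\<Sum>k<a + t. j choose k) = (\<Sum>k<a. j choose k) + binomial_window t j a"
  unfolding binomial_window_def by (induction t) auto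

lemma simplicial_rank_le_add_width:
  assumes "finite X" "finite Y" "card (Y - X) \<le> t"
  shows "simplicial_rank n Y \<le> simplicial_rank n X + hamming_width t n"
proof -
  have "(\<Sum>k<card (Y \<inter> {..j}). j choose k) \<le>
      (\<Sum>k<card (X \<inter> {..j}). j choose k) + binomial_window t j ((j + 1 - t) div 2)" for j
  proof -
    let ?a = "card (X \<inter> {..j})"
    have "card (Y \<inter> {..j}) \<le> card (X \<inter> {..j} \<union> (Y - X))" using assms by (intro card_mono) auto
    also have "\<dots> \<le> ?a + t" using card_Un_le[of "X \<inter> {..j}" "Y - X"] assms by linarith
    finally have "(\<Sum>k<card (Y \<inter> {..j}). j choose k) \<le> (\<Sum>k<?a + t. j choose k)"
      by (intro sum_mono2) auto
    also have "\<dots> = (\<Sum>k<?a. j choose k) + binomial_window t j ?a" by (rule sum_binomial_add_window)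
    also have "\<dots> \<le> (\<Sum>k<?a. j choose k) + binomial_window t j ((j + 1 - t) div 2)"
      using binomial_window_le_central by simp
    finally show ?thesis .
  qed
  then show ?thesis unfolding simplicial_rank_def hamming_width_def sum.distrib[symmetric]
    by (intro sum_mono)
qed

text \<open>For every \<open>j < n\<close> its trace on \<open>{..j}\<close> has exactly as many
  elements as the start of the central window in row \<open>j\<close>, so a single set is extremal
  in all rows at once.\<close>

definition extremal_set :: "nat \<Rightarrow> nat \<Rightarrow> nat set" where
  "extremal_set t n = {i. i < n \<and> t < i \<and> odd (i - t)}"

lemma card_extremal_set:
  assumes "j < n"
  shows "card (extremal_set t n \<inter> {..j}) = (j + 1 - t) div 2"
proof -
  have "card {i. i \<le> j \<and> t < i \<and> odd (i - t)} = (j + 1 - t) div 2"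
  proof (induction j)
    case (Suc j)
    have "{i. i \<le> Suc j \<and> t < i \<and> odd (i - t)} =
       (if t < Suc j \<and> odd (Suc j - t) then insert (Suc j) {i. i \<le> j \<and> t < i \<and> odd (i - t)}
        else {i. i \<le> j \<and> t < i \<and> odd (i - t)})"
      by (auto simp: le_Suc_eq)
    moreover have "finite {i. i \<le> j \<and> t < i \<and> odd (i - t)}" by simp
    moreover have "(Suc j + 1 - t) div 2 = (if t < Suc j \<and> odd (Suc j - t) then Suc ((j + 1 - t) div 2)
      else (j + 1 - t) div 2)"
    proof (cases "t < Suc j")
      case True
      then obtain d where "Suc j = t + Suc d" by (auto dest: less_imp_Suc_add)
      then show ?thesis by (auto elim: oddE evenE)
    qed (auto simp: not_less le_Suc_eq)
    ultimately show ?case using Suc by (simp split: if_splits)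
  qed auto
  moreover have "extremal_set t n \<inter> {..j} = {i. i \<le> j \<and> t < i \<and> odd (i - t)}"
    using assms by (auto simp: extremal_set_def)
  ultimately show ?thesis by simp
qed

lemma simplicial_rank_extremal_set:
  "simplicial_rank n (extremal_set t n \<union> {..<t}) = simplicial_rank n (extremal_set t n) + hamming_width t n"
proof -
  let ?u = "extremal_set t n"
  have "(\<Sum>k<card ((?u \<union> {..<t}) \<inter> {..j}). j choose k) =
      (\<Sum>k<card (?u \<inter> {..j}). j choose k) + binomial_window t j ((j + 1 - t) div 2)" if j: "j < n" for j
  proof -
    have "(?u \<union> {..<t}) \<inter> {..j} = (?u \<inter> {..j}) \<union> {..<min t (Suc j)}" by auto
    moreover have "(?u \<inter> {..j}) \<inter> {..<min t (Suc j)} = {}" by (auto simp: extremal_set_def)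
    ultimately have c: "card ((?u \<union> {..<t}) \<inter> {..j}) = (j + 1 - t) div 2 + min t (Suc j)"
      using card_extremal_set[OF j] by (simp add: card_Un_disjoint)
    show ?thesis
    proof (cases "t \<le> Suc j")
      case True
      then show ?thesis unfolding c card_extremal_set[OF j] by (simp only: min_absorb1 sum_binomial_add_window)
    next
      case False
      \<comment> \<open>The trace gains only \<open>Suc j < t\<close> elements here, but row
        \<open>j\<close> has no further nonzero entries.\<close>
      have "(\<Sum>k<Suc j. j choose k) = (\<Sum>k<t. j choose k)"
        using False by (intro sum.mono_neutral_left) auto
      then show ?thesis using False unfolding c card_extremal_set[OF j] by (simp add: binomial_window_def)
    qed
  qed
  then show ?thesis unfolding simplicial_rank_def hamming_width_def by (simp add: sum.distrib)
qed

section \<open>Iterated neighbourhoods and Hamming balls\<close>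

lemma funpow_cube_nbhd_initial:
  assumes "S \<subseteq> {..<N}" "initial_segment (simplicial_key N) (Pow S) I"
  shows "initial_segment (simplicial_key N) (Pow S) ((cube_nbhd S ^^ r) I)"
  using assms by (induction r) (auto intro: initial_segment_cube_nbhd)

lemma funpow_cube_nbhd_subset_Pow:
  "A \<subseteq> Pow S \<Longrightarrow> (cube_nbhd S ^^ r) A \<subseteq> Pow S"
  by (cases r) (simp_all add: cube_nbhd_subset)

lemma card_funpow_cube_nbhd_mono:
  assumes "S \<subseteq> {..<N}" "A \<subseteq> Pow S" "initial_segment (simplicial_key N) (Pow S) I" "card I \<le> card A"
  shows "card ((cube_nbhd S ^^ r) I) \<le> card ((cube_nbhd S ^^ r) A)"
proof (induction r)
  case (Suc r)
  then show ?case
    using harper_vertex_isoperimetry[OF assms(1) funpow_cube_nbhd_subset_Pow[OF assms(2)]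
      funpow_cube_nbhd_initial[OF assms(1,3)], of r r] by simp
qed (use assms in simp)

lemma funpow_cube_nbhd_dist:
  assumes "finite S" "A \<subseteq> Pow S" "Y \<in> (cube_nbhd S ^^ r) A"
  shows "\<exists>X\<in>A. card (sym_diff X Y) \<le> r"
  using assms(3)
proof (induction r arbitrary: Y)
  case 0
  then show ?case by (intro bexI[of _ Y]) auto
next
  case (Suc r)
  then have "Y \<in> cube_nbhd S ((cube_nbhd S ^^ r) A)" by simp
  then obtain Z i where Z: "Z \<in> (cube_nbhd S ^^ r) A" "Z - {i} = Y - {i}"
    unfolding cube_nbhd_def[of S "(cube_nbhd S ^^ r) A"] by blast
  from Suc.IH[OF Z(1)] obtain X where X: "X \<in> A" "card (sym_diff X Z) \<le> r" ..
  have "X \<subseteq> S" using X(1) assms(2) by blast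
  then have "finite X" using assms(1) by (rule finite_subset)
  have "Z \<subseteq> S" using Z(1) funpow_cube_nbhd_subset_Pow[OF assms(2), of r] by blast
  then have "finite Z" using assms(1) by (rule finite_subset)
  with \<open>finite X\<close> have fin: "finite (insert i (sym_diff X Z))" by simp
  have "x \<in> Y \<longleftrightarrow> x \<in> Z" if "x \<noteq> i" for x using Z(2) that by (metis Diff_iff singletonD)
  then have "sym_diff X Y \<subseteq> insert i (sym_diff X Z)" by auto
  then have "card (sym_diff X Y) \<le> card (insert i (sym_diff X Z))" using fin by (rule card_mono[rotated])
  also have "\<dots> \<le> Suc (card (sym_diff X Z))" using fin by (simp add: card_insert_if)
  also have "\<dots> \<le> Suc r" using X(2) by simp
  finally show ?case using X by blast
qed

text \<open>The size of \<open>A\<close> is that of the initial segment ending at \<open>?u\<close>.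
  Its \<open>t\<close>-fold neighbourhood is initial and contains \<open>?v\<close>, hence
  everything up to \<open>?v\<close>; the ranks of \<open>?u\<close> and \<open>?v\<close> differ by
  the width.\<close>

lemma hamming_ball_card_lower:
  assumes A: "A \<subseteq> Pow {..<n}" "card A = Suc (simplicial_rank n (extremal_set t n))" and t: "t \<le> n"
  shows "card A + hamming_width t n \<le> card {Y. Y \<subseteq> {..<n} \<and> (\<exists>X\<in>A. card (sym_diff X Y) \<le> t)}"
proof -
  let ?S = "{..<n}" and ?k = "simplicial_key n" and ?u = "extremal_set t n"
  let ?v = "?u \<union> {..<t}"
  let ?le = "\<lambda>X. {Y. Y \<subseteq> ?S \<and> ?k Y \<le> ?k X}"
  have uS: "?u \<subseteq> ?S" by (auto simp: extremal_set_def)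
  then have vS: "?v \<subseteq> ?S" using t by auto
  have card_le: "card (?le X) = Suc (simplicial_rank n X)" if "X \<subseteq> ?S" for X
  proof -
    have "Y = X" if "Y \<subseteq> ?S" "?k Y = ?k X" for Y
      using inj_on_simplicial_key[of n] that \<open>X \<subseteq> ?S\<close> by (auto dest: inj_onD)
    then have "?le X = insert X {Y. Y \<subseteq> ?S \<and> ?k Y < ?k X}" using that by (auto simp: order_le_less)
    then show ?thesis using card_simplicial_less[OF that, of n] by simp
  qed
  have I: "initial_segment ?k (Pow ?S) (?le ?u)" by (auto simp: initial_segment_def)
  \<comment> \<open>Each neighbourhood step adds one further element of
    \<open>{..<t}\<close>.\<close>
  have "?u \<union> {..<r} \<in> (cube_nbhd ?S ^^ r) (?le ?u)" if "r \<le> t" for r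
    using that
  proof (induction r)
    case 0
    then show ?case using uS by simp
  next
    case (Suc r)
    then have "insert r (?u \<union> {..<r}) \<in> cube_nbhd ?S ((cube_nbhd ?S ^^ r) (?le ?u))"
      using uS t by (intro cube_nbhd_insertI) auto
    then show ?case by (simp add: lessThan_Suc)
  qed
  then have "?v \<in> (cube_nbhd ?S ^^ t) (?le ?u)" by blast
  then have "?le ?v \<subseteq> (cube_nbhd ?S ^^ t) (?le ?u)"
    using initial_segment_memI[OF funpow_cube_nbhd_initial[OF subset_refl I] inj_on_simplicial_key] by blast
  moreover have "finite ((cube_nbhd ?S ^^ t) (?le ?u))"
    by (rule finite_subset[OF funpow_cube_nbhd_subset_Pow[of _ ?S]]) auto
  ultimately have "card (?le ?v) \<le> card ((cube_nbhd ?S ^^ t) (?le ?u))"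
    by (intro card_mono)
  also have "\<dots> \<le> card ((cube_nbhd ?S ^^ t) A)"
    using card_le[OF uS] A by (intro card_funpow_cube_nbhd_mono[OF subset_refl A(1) I]) simp
  also have "\<dots> \<le> card {Y. Y \<subseteq> ?S \<and> (\<exists>X\<in>A. card (sym_diff X Y) \<le> t)}"
    using funpow_cube_nbhd_dist[OF _ A(1)] funpow_cube_nbhd_subset_Pow[OF A(1), of t]
    by (intro card_mono) auto
  finally show ?thesis unfolding card_le[OF vS] simplicial_rank_extremal_set A(2) by simp
qed

section \<open>Pathwidth and bandwidth\<close>

text \<open>Let \<open>w\<close> be a member of \<open>S\<close> whose last bag is latest. A
  boundary vertex \<open>u\<close> shares a bag with a vertex of \<open>S\<close>, no later than the
  last bag of \<open>w\<close>, and survives at least that long. By convexity \<open>u\<close> lies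
  in the last bag of \<open>w\<close>.\<close>

lemma path_decomposition_boundary:
  assumes "pair_graph G" "path_decomposition G Xs" "0 < m" "m \<le> card (pverts G)"
  shows "\<exists>S \<subseteq> pverts G. card S = m \<and>
    int (card {u \<in> pverts G - S. \<exists>v\<in>S. (v, u) \<in> parcs G}) \<le> path_decomposition_width Xs"
proof -
  interpret pair_graph G by fact
  note decomp = assms(2)[unfolded path_decomposition_def]
  have Xs: "\<Union>(set Xs) = pverts G" using decomp by (elim conjE)
  have edge_bag: "\<exists>X\<in>set Xs. u \<in> X \<and> v \<in> X" if "(u, v) \<in> parcs G" for u v
    using bspec[OF decomp[THEN conjunct2, THEN conjunct2, THEN conjunct1] that] by simp
  have convex: "Xs ! i \<inter> Xs ! k \<subseteq> Xs ! j" if "i \<le> j" "j \<le> k" "k < length Xs" for i j k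
    using decomp[THEN conjunct2, THEN conjunct2, THEN conjunct2, rule_format, OF that] .
  define last_bag where "last_bag v = Max {i. i < length Xs \<and> v \<in> Xs ! i}" for v
  have last: "last_bag v < length Xs" "v \<in> Xs ! last_bag v" if "v \<in> pverts G" for v
  proof -
    have "v \<in> \<Union>(set Xs)" unfolding Xs by (rule that)
    then obtain X where "X \<in> set Xs" "v \<in> X" by (rule UnionE)
    then have "\<exists>i. i < length Xs \<and> v \<in> Xs ! i" unfolding in_set_conv_nth by blast
    then have "last_bag v \<in> {i. i < length Xs \<and> v \<in> Xs ! i}" unfolding last_bag_def by (intro Max_in) auto
    then show "last_bag v < length Xs" "v \<in> Xs ! last_bag v" by auto
  qed
  have last_ge: "i \<le> last_bag v" if "i < length Xs" "v \<in> Xs ! i" for i v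
    unfolding last_bag_def using that by (intro Max_ge) auto
  obtain S where S: "initial_segment last_bag (pverts G) S" "card S = m"
    using initial_segment_exists[OF pair_finite_verts assms(4)] by blast
  have SV: "S \<subseteq> pverts G" using S by (simp add: initial_segment_def)
  have neS: "S \<noteq> {}" using S(2) assms(3) by auto
  have finS: "finite S" using SV pair_finite_verts by (rule finite_subset)
  have "Max (last_bag ` S) \<in> last_bag ` S" using finS neS by (intro Max_in) auto
  then obtain w where w: "w \<in> S" "last_bag w = Max (last_bag ` S)" by auto
  let ?X = "Xs ! last_bag w"
  let ?B = "{u \<in> pverts G - S. \<exists>v\<in>S. (v, u) \<in> parcs G}"
  have wV: "w \<in> pverts G" using w SV by blast
  have XV: "?X \<in> set Xs" using last(1)[OF wV] by simp
  then have "?X \<subseteq> pverts G" unfolding Xs[symmetric] by (rule Union_upper)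
  then have finX: "finite ?X" using pair_finite_verts by (rule finite_subset)
  have "?B \<subseteq> ?X"
  proof
    fix u assume "u \<in> ?B"
    then obtain v where u: "u \<in> pverts G" "u \<notin> S" and v: "v \<in> S" "(v, u) \<in> parcs G" by blast
    obtain i where i: "i < length Xs" "v \<in> Xs ! i" "u \<in> Xs ! i"
      using edge_bag[OF v(2)] by (auto simp: in_set_conv_nth)
    have "i \<le> last_bag v" using last_ge i by blast
    also have "\<dots> \<le> last_bag w" using w(2) v(1) finS by simp
    finally have "i \<le> last_bag w" .
    moreover have "last_bag w \<le> last_bag u" using S(1) w(1) u by (auto simp: initial_segment_def)
    ultimately have "Xs ! i \<inter> Xs ! last_bag u \<subseteq> ?X" using convex last(1)[OF u(1)] by blast
    then show "u \<in> ?X" using i last(2)[OF u(1)] by blast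
  qed
  \<comment> \<open>The extra vertex \<open>w\<close> in the bag pays for the \<open>-1\<close> in
    the width.\<close>
  moreover have "w \<in> ?X" "w \<notin> ?B" using last(2)[OF wV] w(1) by auto
  ultimately have "?B \<subset> ?X" by blast
  then have "card ?B < card ?X" using finX by (intro psubset_card_mono)
  also have "card ?X \<le> (SUP X \<in> set Xs. card X)" using XV by (rule cSUP_upper) simp
  finally show ?thesis using SV S(2) unfolding path_decomposition_width_def by (intro exI[of _ S]) auto
qed

text \<open>Sliding a window of \<open>b + 1\<close> consecutive labels along an optimal labelling
  gives the bags; an edge lies in the bag that starts at its smaller label.\<close>

lemma pathwidth_le_bandwidth:
  assumes "pair_graph G"
  shows "pathwidth G \<le> int (bandwidth G)"
proof -
  interpret pair_graph G by fact
  define b where "b = bandwidth G"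
  obtain \<phi> where \<phi>: "bij_betw \<phi> (pverts G) {1..card (pverts G)}"
    and edge: "\<And>u v. (u, v) \<in> parcs G \<Longrightarrow> \<bar>int (\<phi> u) - int (\<phi> v)\<bar> \<le> int b"
    using bandwidth_le_iff[OF assms, of b] by (auto simp: b_def)
  define N where "N = card (pverts G)"
  define bag where "bag i = {v \<in> pverts G. i \<le> \<phi> v \<and> \<phi> v \<le> i + b}" for i
  define Xs where "Xs = map bag [0..<Suc N]"
  have \<phi>N: "\<phi> v < Suc N" if "v \<in> pverts G" for v
    using bij_betwE[OF \<phi>] that by (auto simp: N_def less_Suc_eq_le)
  have setXs: "set Xs = bag ` {..<Suc N}" by (simp add: Xs_def atLeast0LessThan del: upt_Suc)
  have nth: "Xs ! i = bag i" if "i < length Xs" for i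
    using that by (simp add: Xs_def del: upt_Suc)
  have "path_decomposition G Xs"
    unfolding path_decomposition_def
  proof (intro conjI allI impI)
    show "Xs \<noteq> []" by (simp add: Xs_def)
    have "v \<in> \<Union>(set Xs)" if "v \<in> pverts G" for v
      unfolding setXs using that \<phi>N[OF that] by (intro UN_I[of "\<phi> v"]) (auto simp: bag_def)
    then show "\<Union>(set Xs) = pverts G" unfolding setXs by (auto simp: bag_def)
    show "\<forall>(u, v)\<in>parcs G. \<exists>X\<in>set Xs. u \<in> X \<and> v \<in> X"
    proof (clarify)
      fix u v assume uv: "(u, v) \<in> parcs G"
      then have V: "u \<in> pverts G" "v \<in> pverts G" by (auto dest: in_arcsD1 in_arcsD2)
      let ?i = "min (\<phi> u) (\<phi> v)"
      have "u \<in> bag ?i" "v \<in> bag ?i" using V edge[OF uv] by (auto simp: bag_def)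
      moreover have "bag ?i \<in> set Xs" unfolding setXs using \<phi>N[OF V(1)] by (intro imageI) auto
      ultimately show "\<exists>X\<in>set Xs. u \<in> X \<and> v \<in> X" by blast
    qed
    fix i j k assume "i \<le> j" "j \<le> k" "k < length Xs"
    then show "Xs ! i \<inter> Xs ! k \<subseteq> Xs ! j" by (auto simp: nth bag_def)
  qed
  moreover have "card (bag i) \<le> Suc b" for i
  proof -
    have "inj_on \<phi> (bag i)" using \<phi> by (auto simp: bij_betw_def bag_def intro: inj_on_subset)
    then have "card (bag i) \<le> card {i..i + b}" by (rule card_inj_on_le) (auto simp: bag_def)
    then show ?thesis by simp
  qed
  then have "(SUP X \<in> set Xs. card X) \<le> Suc b"
    by (intro cSUP_least) (auto simp: setXs)
  then have "path_decomposition_width Xs \<le> int b" by (simp add: path_decomposition_width_def)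
  ultimately show ?thesis using pathwidth_le_iff[OF assms] b_def by blast
qed

lemma bij_betw_card_less:
  assumes "finite U" "inj_on f U"
  shows "bij_betw (\<lambda>x. card {y \<in> U. f y < (f x :: 'b::linorder)}) U {..<card U}"
proof -
  let ?r = "\<lambda>x. card {y \<in> U. f y < f x}"
  have less: "?r x < ?r y" if "x \<in> U" "y \<in> U" "f x < f y" for x y
    using that assms(1) by (intro psubset_card_mono) auto
  have "inj_on ?r U"
  proof (rule inj_onI)
    fix x y assume "x \<in> U" "y \<in> U" "?r x = ?r y"
    then have "f x = f y" using less[of x y] less[of y x] by (cases "f x" "f y" rule: linorder_cases) auto
    then show "x = y" using inj_onD[OF assms(2)] \<open>x \<in> U\<close> \<open>y \<in> U\<close> by blast
  qed
  moreover have "?r ` U \<subseteq> {..<card U}" using assms(1) by (auto intro!: psubset_card_mono)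
  ultimately show ?thesis
    unfolding bij_betw_def using card_subset_eq[of "{..<card U}" "?r ` U"] by (simp add: card_image)
qed

section \<open>Transfer from subsets to binary vectors\<close>

definition support :: "bool list \<Rightarrow> nat set" where
  "support x = {i. i < length x \<and> x ! i}"

lemma bij_betw_support: "bij_betw support {x. length x = n} (Pow {..<n})"
proof (rule bij_betwI[where g = "\<lambda>X. map (\<lambda>i. i \<in> X) [0..<n]"])
  fix x :: "bool list" assume "x \<in> {x. length x = n}"
  then show "map (\<lambda>i. i \<in> support x) [0..<n] = x" by (auto simp: support_def intro: nth_equalityI)
qed (auto simp: support_def)

lemma finite_support: "finite (support x)"
  by (simp add: support_def)

lemma hamming_dist_support:
  "length x = length y \<Longrightarrow> hamming_dist x y = card (sym_diff (support x) (support y))"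
  unfolding hamming_dist_def support_def by (rule arg_cong[where f = card]) auto

lemma card_pverts_binary_hamming_graph: "card (pverts (binary_hamming_graph t n)) = 2 ^ n"
  using bij_betw_same_card[OF bij_betw_support[of n]] by (simp add: binary_hamming_graph_def card_Pow)

lemma bandwidth_binary_hamming_graph_le: "bandwidth (binary_hamming_graph t n) \<le> hamming_width t n"
proof -
  let ?G = "binary_hamming_graph t n"
  define \<phi> where "\<phi> x = Suc (simplicial_rank n (support x))" for x
  have "bij_betw (\<lambda>X. card {Y \<in> Pow {..<n}. simplicial_key n Y < simplicial_key n X})
      (Pow {..<n}) {..<2 ^ n}"
    using bij_betw_card_less[OF _ inj_on_simplicial_key[of n]] by (simp add: card_Pow)
  then have "bij_betw (simplicial_rank n) (Pow {..<n}) {..<2 ^ n}"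
    by (rule bij_betw_cong[THEN iffD1, rotated]) (simp add: card_simplicial_less)
  then have "bij_betw (simplicial_rank n \<circ> support) (pverts ?G) {..<2 ^ n}"
    using bij_betw_trans[OF bij_betw_support] by (simp add: binary_hamming_graph_def)
  moreover have "bij_betw Suc {..<2 ^ n} {1..2 ^ n}"
    by (auto simp: bij_betw_def image_Suc_lessThan)
  ultimately have "bij_betw (Suc \<circ> (simplicial_rank n \<circ> support)) (pverts ?G) {1..2 ^ n}"
    by (rule bij_betw_trans)
  then have bij: "bij_betw \<phi> (pverts ?G) {1..card (pverts ?G)}"
    by (simp add: \<phi>_def[abs_def] comp_def card_pverts_binary_hamming_graph)
  \<comment> \<open>The one-sided bound gives the absolute value, since the distance is
    symmetric.\<close>
  have "\<phi> x \<le> \<phi> y + hamming_width t n" if "length x = n" "length y = n" "hamming_dist x y \<le> t" for x y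
  proof -
    have "card (support x - support y) \<le> card (sym_diff (support x) (support y))"
      by (intro card_mono) (auto simp: finite_support)
    then have "card (support x - support y) \<le> t" using that hamming_dist_support by simp
    then show ?thesis
      using simplicial_rank_le_add_width[OF finite_support finite_support] by (simp add: \<phi>_def)
  qed
  then have "\<forall>(u, v) \<in> parcs ?G. \<bar>int (\<phi> u) - int (\<phi> v)\<bar> \<le> int (hamming_width t n)"
    by (fastforce simp: binary_hamming_graph_def abs_le_iff hamming_dist_commute)
  then show ?thesis using bandwidth_le_iff[OF pair_graph_binary_hamming_graph] bij by blast
qed

lemma simplicial_rank_less: "X \<subseteq> {..<n} \<Longrightarrow> simplicial_rank n X < 2 ^ n"
proof -
  assume X: "X \<subseteq> {..<n}"
  have "card {Y. Y \<subseteq> {..<n} \<and> simplicial_key n Y < simplicial_key n X} < card (Pow {..<n})"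
    using X by (intro psubset_card_mono) auto
  then show ?thesis using card_simplicial_less[OF X, of n] by (simp add: card_Pow)
qed

lemma hamming_width_le_pathwidth:
  assumes "t \<le> n"
  shows "int (hamming_width t n) \<le> pathwidth (binary_hamming_graph t n)"
proof -
  let ?G = "binary_hamming_graph t n" and ?u = "extremal_set t n"
  let ?V = "{x :: bool list. length x = n}"
  have V: "pverts ?G = ?V" by (simp add: binary_hamming_graph_def)
  obtain Xs where Xs: "path_decomposition ?G Xs" "path_decomposition_width Xs \<le> pathwidth ?G"
    using pathwidth_le_iff[OF pair_graph_binary_hamming_graph] by blast
  have "?u \<subseteq> {..<n}" by (auto simp: extremal_set_def)
  then have "Suc (simplicial_rank n ?u) \<le> card (pverts ?G)"
    using simplicial_rank_less[of ?u n] by (simp add: card_pverts_binary_hamming_graph Suc_le_eq)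
  then obtain S where S: "S \<subseteq> ?V" "card S = Suc (simplicial_rank n ?u)"
    and bd: "int (card {u \<in> ?V - S. \<exists>v\<in>S. (v, u) \<in> parcs ?G}) \<le> path_decomposition_width Xs"
    using path_decomposition_boundary[OF pair_graph_binary_hamming_graph Xs(1), of "Suc (simplicial_rank n ?u)"]
    unfolding V by auto
  let ?B = "{u \<in> ?V - S. \<exists>v\<in>S. (v, u) \<in> parcs ?G}"
  let ?A = "support ` S"
  have inj: "inj_on support ?V" and im: "support ` ?V = Pow {..<n}"
    using bij_betw_support[of n] by (auto simp: bij_betw_def)
  have finV: "finite ?V" using bij_betw_finite[OF bij_betw_support[of n]] by simp
  have A: "?A \<subseteq> Pow {..<n}" "card ?A = card S"
    using im S(1) card_image[OF inj_on_subset[OF inj S(1)]] by auto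
  \<comment> \<open>The ball of radius \<open>t\<close> around \<open>S\<close> is covered by
    \<open>S\<close> and its outer boundary, so its excess over \<open>card S\<close> bounds the
    boundary from below.\<close>
  have "{Y. Y \<subseteq> {..<n} \<and> (\<exists>X\<in>?A. card (sym_diff X Y) \<le> t)} \<subseteq> support ` (S \<union> ?B)"
  proof
    fix Y assume "Y \<in> {Y. Y \<subseteq> {..<n} \<and> (\<exists>X\<in>?A. card (sym_diff X Y) \<le> t)}"
    then obtain x where x: "x \<in> S" "card (sym_diff (support x) Y) \<le> t" and "Y \<in> support ` ?V"
      unfolding im by blast
    then obtain y where y: "y \<in> ?V" "Y = support y" by blast
    have "y \<in> S \<union> ?B"
    proof (cases "y \<in> S")
      case False
      then have "(x, y) \<in> parcs ?G"
        using x y S(1) hamming_dist_support[of x y] by (auto simp: binary_hamming_graph_def)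
      then show ?thesis using x(1) y(1) False by blast
    qed simp
    then show "Y \<in> support ` (S \<union> ?B)" using y by blast
  qed
  moreover have finSB: "finite (S \<union> ?B)" using S(1) finV finite_subset by auto
  ultimately have "card {Y. Y \<subseteq> {..<n} \<and> (\<exists>X\<in>?A. card (sym_diff X Y) \<le> t)} \<le> card (S \<union> ?B)"
    by (meson card_image_le card_mono finite_imageI order_trans)
  also have "\<dots> \<le> card S + card ?B" by (rule card_Un_le)
  finally have "hamming_width t n \<le> card ?B"
    using hamming_ball_card_lower[OF A(1) _ assms] A(2) S(2) by simp
  then show ?thesis using bd Xs(2) by linarith
qed

section \<open>The closed form\<close>

lemma binomial_int_of_nat: "binomial_int (int n) (int k) = int (n choose k)"
  by (simp add: binomial_int_def binomial_eq_0)

lemma binomial_int_Suc: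
  "binomial_int (int (Suc n)) k = binomial_int (int n) k + binomial_int (int n) (k - 1)"
proof (cases "k \<le> 0")
  case True
  then show ?thesis by (auto simp: binomial_int_def)
next
  case False
  then obtain j where "k = int (Suc j)" by (metis gr0_implies_Suc not_le zero_less_imp_eq_int)
  then show ?thesis using binomial_int_of_nat[of "Suc n" "Suc j"] binomial_int_of_nat[of n "Suc j"]
    binomial_int_of_nat[of n j] by simp
qed

lemma sum_int_interval:
  fixes s :: int and f :: "int \<Rightarrow> 'a::comm_monoid_add"
  shows "(\<Sum>k = s..s + int m - 1. f k) = (\<Sum>i<m. f (s + int i))"
proof (induction m)
  case (Suc m)
  have "{s..s + int (Suc m) - 1} = insert (s + int m) {s..s + int m - 1}" by auto
  then show ?case using Suc by (simp add: add.commute)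
qed simp

lemma int_binomial_window:
  "int (binomial_window t j a) = (\<Sum>i<t. binomial_int (int j) (int a + int i))"
  unfolding binomial_window_def of_nat_sum
  by (intro sum.cong) (use binomial_int_of_nat in \<open>metis of_nat_add\<close>)+

text \<open>Both sides equal \<open>2 ^ t - 1\<close>: for \<open>j < t\<close> the window is the
  full row \<open>j\<close>, and on the right only the last entry of row \<open>t\<close> is
  absent.\<close>

lemma hamming_width_self_conv: "hamming_width t t = (\<Sum>k<t. t choose k)"
proof -
  have "hamming_width t t = (\<Sum>j<t. 2 ^ j)"
    unfolding hamming_width_def
  proof (rule sum.cong)
    fix j assume "j \<in> {..<t}"
    then have "(\<Sum>k<t. j choose k) = (\<Sum>k\<le>j. j choose k)" by (intro sum.mono_neutral_right) auto
    then show "binomial_window t j ((j + 1 - t) div 2) = 2 ^ j"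
      using \<open>j \<in> {..<t}\<close> by (simp add: binomial_window_def choose_row_sum)
  qed simp
  moreover have "(\<Sum>k<t. t choose k) + 1 = 2 ^ t"
    using choose_row_sum[of t] by (simp add: lessThan_Suc_atMost[symmetric])
  moreover have "(\<Sum>j<t. 2 ^ j) + 1 = (2::nat) ^ t" by (induction t) auto
  ultimately show ?thesis by linarith
qed

lemma hamming_width_closed_form:
  "int (hamming_width t (t + d)) =
    (\<Sum>i<t. binomial_int (int (t + d)) (int d div 2 + int i)) +
    (\<Sum>a = 0..(int d - 1) div 2.
       binomial_int (int t + 2 * a) (int t + a - 1) - binomial_int (int t + 2 * a) (a - 1))"
proof (induction d)
  \<comment> \<open>Integer division gives \<open>(0 - 1) div 2 = -1\<close>, so the second sum is
    empty.\<close>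
  case 0
  then show ?case by (simp add: hamming_width_self_conv binomial_int_of_nat)
next
  case (Suc d)
  let ?b = "binomial_int (int (t + d))"
  let ?g = "\<lambda>a. binomial_int (int t + 2 * a) (int t + a - 1) - binomial_int (int t + 2 * a) (a - 1)"
  let ?s = "int (Suc d) div 2"
  have "int (hamming_width t (t + Suc d)) = int (hamming_width t (t + d)) + (\<Sum>i<t. ?b (?s + int i))"
    by (simp add: hamming_width_def int_binomial_window zdiv_int)
  \<comment> \<open>Pascal's rule splits the new window into two windows of row
    \<open>t + d\<close>. The first is the summand that the width gains.\<close>
  moreover have "(\<Sum>i<t. binomial_int (int (t + Suc d)) (?s + int i)) =
      (\<Sum>i<t. ?b (?s + int i)) + (\<Sum>i<t. ?b (?s - 1 + int i))"
    using binomial_int_Suc[of "t + d"] by (simp add: sum.distrib[symmetric] algebra_simps)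
  \<comment> \<open>The second window is the old one if \<open>d\<close> is odd. If
    \<open>d = 2 * a\<close>, it starts one entry earlier, and the difference of the two end entries
    is exactly the new term \<open>?g a\<close>.\<close>
  moreover have "(\<Sum>i<t. ?b (?s - 1 + int i)) + (\<Sum>a = 0..(int (Suc d) - 1) div 2. ?g a) =
     (\<Sum>i<t. ?b (int d div 2 + int i)) + (\<Sum>a = 0..(int d - 1) div 2. ?g a)"
  proof (cases "even d")
    case True
    then obtain a where d: "d = 2 * a" by blast
    have dv: "?s = int a" "int d div 2 = int a" "(int (Suc d) - 1) div 2 = int a" "(int d - 1) div 2 = int a - 1"
      unfolding d by simp_all
    have "{0..int a} = insert (int a) {0..int a - 1}" by auto
    then have "(\<Sum>a = 0..int a. ?g a) = ?g (int a) + (\<Sum>a = 0..int a - 1. ?g a)" by simp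
    moreover have "(\<Sum>i<t. ?b (int a - 1 + int i)) + ?b (int a - 1 + int t) =
        ?b (int a - 1) + (\<Sum>i<t. ?b (int a + int i))"
      using sum.lessThan_Suc_shift[of "\<lambda>i. ?b (int a - 1 + int i)" t] by (simp add: algebra_simps)
    ultimately show ?thesis unfolding dv by (simp add: d algebra_simps)
  next
    case False
    then obtain a where d: "d = 2 * a + 1" by (auto elim: oddE)
    have "?s = int a + 1" "int d div 2 = int a" "(int (Suc d) - 1) div 2 = int a" "(int d - 1) div 2 = int a"
      unfolding d by simp_all
    then show ?thesis by simp
  qed
  ultimately show ?case using Suc by simp
qed

theorem theorem1p1:
  fixes t n :: nat
  assumes "0 < t" and "t < n"
  shows "pathwidth (binary_hamming_graph t n) = int (bandwidth (binary_hamming_graph t n)) \<and>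
    int (bandwidth (binary_hamming_graph t n)) =
      (\<Sum>k = (int n - int t) div 2 .. (int n - int t) div 2 + int t - 1. binomial_int (int n) k) +
      (\<Sum>a = 0 .. (int n - int t - 1) div 2.
         binomial_int (int t + 2 * a) (int t + a - 1) - binomial_int (int t + 2 * a) (a - 1))"
proof -
  define d where "d = n - t"
  have d: "n = t + d" "int n - int t = int d" using assms by (auto simp: d_def)
  let ?G = "binary_hamming_graph t n" and ?W = "hamming_width t n"
  have "int ?W \<le> pathwidth ?G" using assms by (intro hamming_width_le_pathwidth) simp
  moreover have "pathwidth ?G \<le> int (bandwidth ?G)"
    by (rule pathwidth_le_bandwidth[OF pair_graph_binary_hamming_graph])
  moreover have "int (bandwidth ?G) \<le> int ?W" using bandwidth_binary_hamming_graph_le by simp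
  ultimately have "pathwidth ?G = int (bandwidth ?G)" "int (bandwidth ?G) = int ?W" by linarith+
  then show ?thesis unfolding d(2) sum_int_interval d(1) hamming_width_closed_form by simp
qed

end
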